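(* Suppose $(\mathbb{X},d,\nu)$ satisfies Assumption (A). Let $\Lambda\subseteq\mathbb{X}$ be bounded and measurable, $\lambda\in\mathbb{C}$, and let $\Phi$ be a collection of symmetric repulsive potentials that is closed under modification and $\delta$-zero-free on $\Lambda$ at activity $\lambda$ for some $\delta>0$. Then for every $\phi\in\Phi$ and every $y\in\mathbb{X}$, the modified point densities (on $\Lambda$, at activity $\lambda$) satisfy $$\kappa(y)=\lambda\exp\left(-\sum_{k\in\mathbb{N}}\frac{1}{k!}\int_{\Lambda^k}\left(1-e^{-\phi(y,\mathbf{w})}\right)e^{-H(\mathbf{w}\mid y_{\prec\mathbf{w}})}\,\kappa(\mathbf{w}\mid y_{\prec\mathbf{w}})\,\nu^k(d\mathbf{w})\right).$$
   Context: $(\mathbb{X},d)$ is a complete separable metric space with a locally finite Borel measure $\nu$. Assumption (A): for every $x\in\mathbb{X}$, the push-forward of $\nu$ under $y\mapsto d(x,y)$ is absolutely continuous with respect to Lebesgue measure on $\mathbb{R}$. A potential $\phi=(\phi_k)_{k\in\mathbb{N}}$ is a family of measurable $\phi_k:\mathbb{X}^k\to\mathbb{R}\cup\{\infty\}$, written $\phi(\mathbf{x})=\phi_k(\mathbf{x})$; symmetric: invariant under coordinate permutations; repulsive: $\phi_k\ge0$. For $\mathbf{x}\in\mathbb{X}^k$, $S\subseteq[k]$, $\mathbf{x}_S=(x_i)_{i\in S}$; $H(\mathbf{x})=\sum_{\emptyset\ne S\subseteq[k]}\phi(\mathbf{x}_S)$; $Z_{\Lambda,\phi}(\lambda)=\sum_{k\ge0}\frac{\lambda^k}{k!}\int_{\Lambda^k}e^{-H(\mathbf{x})}\nu^k(d\mathbf{x})$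 with $e^{-\infty}=0$. $\phi(y,\mathbf{w})$ is $\phi_{k+1}$ at the concatenated tuple. Pinning: for $\mathbf{x}\in\mathbb{X}^k$, $\phi(\cdot\mid\mathbf{x})$ is the potential $\phi(\mathbf{y}\mid\mathbf{x})=\sum_{S\subseteq[k]}\phi(\mathbf{y},\mathbf{x}_S)$ ($S=\emptyset$ gives $\phi(\mathbf{y})$); $Z_{\Lambda,\phi}(\lambda\mid\mathbf{x})$ is its partition function. Modified $k$-point density: if $Z_{\Lambda,\phi}(\lambda)\neq0$, $\kappa(\mathbf{x})=\kappa_{\Lambda,\phi,\lambda}(\mathbf{x})=\lambda^kZ_{\Lambda,\phi}(\lambda\mid\mathbf{x})/Z_{\Lambda,\phi}(\lambda)$ for $\mathbf{x}\in\mathbb{X}^k$. Fix $z\in\mathbb{X}$ and set $D(\mathbf{x})=\sum_j d(z,x_j)$. Write $\mathbf{x}\prec t$ if $D(\mathbf{x})<t$ ($t\in[0,\infty]$) and $\mathbf{x}\prec\mathbf{w}$ if $D(\mathbf{x})<D(\mathbf{w})$. Partial pinning: for $y\in\mathbb{X}$, $\phi(\mathbf{x}\mid y_{\prec t})=\phi(\mathbf{x}\mid y)$ if $\mathbf{x}\prec t$ and $=\phi(\mathbf{x})$ otherwise; $\phi(\cdot\mid y_{\prec\mathbf{w}}):=\phi(\cdot\mid y_{\prec D(\mathbf{w})})$. $H(\cdot\mid y_{\prec\mathbf{w}})$ and $\kappa(\cdot\mid y_{\prec\mathbf{w}})$ are the Hamiltonian and modified point density (on $\Lambda$ at $\lambda$)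 for the potential $\phi(\cdot\mid y_{\prec\mathbf{w}})$; thus $\kappa(\mathbf{w}\mid y_{\prec\mathbf{w}})=\lambda^kZ_{\Lambda,\phi(\cdot\mid y_{\prec\mathbf{w}})}(\lambda\mid\mathbf{w})/Z_{\Lambda,\phi(\cdot\mid y_{\prec\mathbf{w}})}(\lambda)$ for $\mathbf{w}\in\mathbb{X}^k$. $\Phi$ is $\delta$-zero-free on $\Lambda$ at $\lambda$ if $|Z_{\Lambda,\phi}(\lambda)|\ge\delta$ for all $\phi\in\Phi$. $\Phi$ is closed under modification if (1) for all $\phi\in\Phi$, $y\in\mathbb{X}$, $t\in[0,\infty]$, $\phi(\cdot\mid y_{\prec t})\in\Phi$, and (2) for all $\phi\in\Phi$ and measurable $\Delta\subseteq\mathbb{X}$, the potential $\psi$ with $\psi_k=\phi_k$ for $k\ge2$ and $\psi_1=\infty$ on $\Delta$, $\psi_1=\phi_1$ off $\Delta$, lies in $\Phi$. *)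

theory Defs
  imports "HOL-Analysis.Analysis"
begin

text \<open>Tuples in X^k are represented as lists of length k. A potential is a single
  function on lists; phi_k is its restriction to lists of length k. Values lie in
  real union {infinity}, represented in ereal (value -infinity is excluded).\<close>

type_synonym 'a potential = "'a list \<Rightarrow> ereal"

definition tup :: "nat \<Rightarrow> (nat \<Rightarrow> 'a) \<Rightarrow> 'a list" where
  "tup k x = map x [0..<k]"

definition nuL :: "'a measure \<Rightarrow> 'a set \<Rightarrow> nat \<Rightarrow> (nat \<Rightarrow> 'a) measure" where
  "nuL \<nu> \<Lambda> k = PiM {..<k} (\<lambda>_. restrict_space \<nu> \<Lambda>)"

text \<open>Assumption (A) together with the standing assumptions on nu
  (Borel measure, locally finite = finite on bounded Borel sets).\<close>
definition assumption_A :: "('a::polish_space) measure \<Rightarrow> bool" where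
  "assumption_A \<nu> \<longleftrightarrow>
     sets \<nu> = sets borel \<and>
     (\<forall>B. bounded B \<and> B \<in> sets borel \<longrightarrow> emeasure \<nu> B < \<infinity>) \<and>
     (\<forall>x. absolutely_continuous lborel (distr \<nu> lborel (\<lambda>y. dist x y)))"

definition is_potential :: "'a measure \<Rightarrow> 'a potential \<Rightarrow> bool" where
  "is_potential \<nu> \<phi> \<longleftrightarrow> (\<forall>xs. \<phi> xs \<noteq> -\<infinity>) \<and>
     (\<forall>k. (\<lambda>x. \<phi> (tup k x)) \<in> borel_measurable (PiM {..<k} (\<lambda>_. \<nu>)))"

definition symmetric_pot :: "'a potential \<Rightarrow> bool" where
  "symmetric_pot \<phi> \<longleftrightarrow> (\<forall>xs ys. mset xs = mset ys \<longrightarrow> \<phi> xs = \<phi> ys)"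

definition repulsive_pot :: "'a potential \<Rightarrow> bool" where
  "repulsive_pot \<phi> \<longleftrightarrow> (\<forall>xs. \<phi> xs \<ge> 0)"

definition expm :: "ereal \<Rightarrow> real" where
  "expm v = (if v = \<infinity> then 0 else exp (- real_of_ereal v))"

definition Ham :: "'a potential \<Rightarrow> 'a list \<Rightarrow> ereal" where
  "Ham \<phi> xs = (\<Sum>S\<in>Pow {0..<length xs} - {{}}. \<phi> (nths xs S))"

definition Zpart :: "'a measure \<Rightarrow> 'a set \<Rightarrow> 'a potential \<Rightarrow> complex \<Rightarrow> complex" where
  "Zpart \<nu> \<Lambda> \<phi> lam = (\<Sum>k. lam ^ k / of_real (fact k) *
      of_real (\<integral>x. expm (Ham \<phi> (tup k x)) \<partial>nuL \<nu> \<Lambda> k))"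

definition pin :: "'a potential \<Rightarrow> 'a list \<Rightarrow> 'a potential" where
  "pin \<phi> xs = (\<lambda>ys. \<Sum>S\<in>Pow {0..<length xs}. \<phi> (ys @ nths xs S))"

text \<open>modified k-point density (division by zero gives 0, irrelevant when Z is nonzero)\<close>
definition kappa :: "'a measure \<Rightarrow> 'a set \<Rightarrow> 'a potential \<Rightarrow> complex \<Rightarrow> 'a list \<Rightarrow> complex" where
  "kappa \<nu> \<Lambda> \<phi> lam xs = lam ^ length xs * Zpart \<nu> \<Lambda> (pin \<phi> xs) lam / Zpart \<nu> \<Lambda> \<phi> lam"

definition Dz :: "'a::metric_space \<Rightarrow> 'a list \<Rightarrow> real" where
  "Dz z xs = sum_list (map (dist z) xs)"

definition ppin :: "'a::metric_space \<Rightarrow> 'a potential \<Rightarrow> 'a \<Rightarrow> ereal \<Rightarrow> 'a potential" where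
  "ppin z \<phi> y t = (\<lambda>xs. if ereal (Dz z xs) < t then pin \<phi> [y] xs else \<phi> xs)"

definition ppinw :: "'a::metric_space \<Rightarrow> 'a potential \<Rightarrow> 'a \<Rightarrow> 'a list \<Rightarrow> 'a potential" where
  "ppinw z \<phi> y w = ppin z \<phi> y (ereal (Dz z w))"

definition zero_free :: "'a measure \<Rightarrow> 'a set \<Rightarrow> complex \<Rightarrow> real \<Rightarrow> 'a potential set \<Rightarrow> bool" where
  "zero_free \<nu> \<Lambda> lam \<delta> \<Phi> \<longleftrightarrow> (\<forall>\<phi>\<in>\<Phi>. norm (Zpart \<nu> \<Lambda> \<phi> lam) \<ge> \<delta>)"

definition closed_under_mod :: "'a::metric_space \<Rightarrow> 'a measure \<Rightarrow> 'a potential set \<Rightarrow> bool" where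
  "closed_under_mod z \<nu> \<Phi> \<longleftrightarrow>
     (\<forall>\<phi>\<in>\<Phi>. \<forall>y t. t \<ge> 0 \<longrightarrow> ppin z \<phi> y t \<in> \<Phi>) \<and>
     (\<forall>\<phi>\<in>\<Phi>. \<forall>\<Delta>\<in>sets \<nu>.
        (\<lambda>xs. if length xs = 1 \<and> hd xs \<in> \<Delta> then \<infinity> else \<phi> xs) \<in> \<Phi>)"

text \<open>k-th term (k >= 1) of the series in the exponent\<close>
definition series_term :: "'a::metric_space \<Rightarrow> 'a measure \<Rightarrow> 'a set \<Rightarrow> 'a potential \<Rightarrow> complex \<Rightarrow> 'a \<Rightarrow> nat \<Rightarrow> complex" where
  "series_term z \<nu> \<Lambda> \<phi> lam y k = 1 / of_real (fact k) *
     (\<integral>x. (let w = tup k x in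
            of_real ((1 - expm (\<phi> (y # w))) * expm (Ham (ppinw z \<phi> y w) w))
            * kappa \<nu> \<Lambda> (ppinw z \<phi> y w) lam w) \<partial>nuL \<nu> \<Lambda> k)"

end

theory Submission
  imports Defs
begin

text \<open>
  Let \<open>T t\<close> be the partition function of the partially pinned potential \<open>\<phi>(\<cdot> | y\<^sub>\<prec>\<^sub>t)\<close>, so that
  \<open>\<kappa>(y) = \<lambda> T \<infinity> / T 0\<close>. For a fixed configuration \<open>x\<close> the Boltzmann factor is a step function of
  \<open>t\<close> that jumps at the values \<open>D(x\<^sub>S)\<close>; by Assumption (A) these are almost surely distinct, so
  each jump switches on a single factor \<open>exp (-\<phi>(y, x\<^sub>S))\<close>. Summing the jumps and splitting
  \<open>x\<close> into \<open>w = x\<^sub>S\<close> and the rest gives the linear equation \<open>dT = -T dM\<close>, where \<open>M t\<close> is the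
  exponent of the theorem restricted to \<open>D(w) < t\<close>. Zero-freeness bounds \<open>dM\<close> by a multiple of
  the measure \<open>dN\<close>, which is atomless, again by (A). Hence \<open>T exp M\<close> has increments of order
  \<open>(N t - N s)\<^sup>2\<close> and is constant on \<open>[0, \<infinity>]\<close>.
\<close>


section \<open>Analytic and combinatorial preliminaries\<close>

text \<open>\<open>T\<close> need not be differentiable in \<open>t\<close>, and \<open>t\<close>
  ranges over \<open>ereal\<close> including the end point \<infinity>. Time is therefore measured
  by the continuous increasing function \<open>N\<close>, the distribution function of D under the
  sum of the measures |lam|^j/j! \<nu>^j on \<Lambda>^j, j \<ge> 1, and derivatives are replaced by
  bounds on increments in powers of \<open>N t - N s\<close>. The strict inequality D(w) < t closes
  the equation: just before w is switched on, the potential is the one pinned at time D(w), so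
  summing over the remaining points yields the numerator of \<kappa>(w | y_{\<prec>w}), whose
  denominator is T(D(w)). The factor T thus appears at the time D(w), which varies inside a window
  [s,t). A Lipschitz bound of \<open>T\<close> against \<open>N\<close> shows that replacing it by
  \<open>T s\<close> costs a second-order error only, and the lower bound \<delta> along the whole
  path permits the division by T(D(w)).\<close>

lemma constant_if_quadratic_increments:
  fixes N :: "'a::linear_continuum_topology \<Rightarrow> real" and E :: "'a \<Rightarrow> 'b::real_normed_vector"
  assumes ab: "a \<le> b" and cont: "continuous_on {a..b} N"
    and mono: "\<And>s t. a \<le> s \<Longrightarrow> s \<le> t \<Longrightarrow> t \<le> b \<Longrightarrow> N s \<le> N t"
    and incr: "\<And>s t. a \<le> s \<Longrightarrow> s \<le> t \<Longrightarrow> t \<le> b \<Longrightarrow> norm (E t - E s) \<le> K * (N t - N s)\<^sup>2"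
  shows "E b = E a"
proof -
  \<comment> \<open>By the intermediate value theorem \<open>N\<close> maps onto [N a, N b]. Along a
    right inverse \<open>r\<close> of \<open>N\<close>, \<open>E\<close> becomes a function of a
    real variable, where derivatives make sense.\<close>
  have "\<exists>t. a \<le> t \<and> t \<le> b \<and> N t = u" if "u \<in> {N a..N b}" for u
    using IVT'[of N a u b] that ab cont by auto
  then obtain r where r: "a \<le> r u" "r u \<le> b" "N (r u) = u" if "u \<in> {N a..N b}" for u
    by metis
  have le: "norm (E t - E s) \<le> K * (N t - N s)\<^sup>2" if "s \<in> {a..b}" "t \<in> {a..b}" for s t
    using incr[of s t] incr[of t s] that
    by (cases "s \<le> t") (auto simp: norm_minus_commute power2_commute)
  \<comment> \<open>\<open>E\<close> is constant on level sets of \<open>N\<close>, so the choice of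
    \<open>r\<close> is harmless; in particular \<open>r (N a)\<close> may differ from
    \<open>a\<close>.\<close>
  have sub: "E s = E t" if "s \<in> {a..b}" "t \<in> {a..b}" "N s = N t" for s t
    using le[OF that(1,2)] that(3) by simp
  have Nab: "N a \<le> N b"
    using mono ab by auto
  define f where "f u = E (r u)" for u
  have "(f has_derivative (\<lambda>h. 0)) (at x within {N a..N b})" if x: "x \<in> {N a..N b}" for x
  \<comment> \<open>The quadratic bound divided by |y - x| is linear in |y - x|, so the derivative
    vanishes everywhere.\<close>
  proof (rule has_derivativeI_sandwich[where e = 1 and H = "\<lambda>y. K * \<bar>y - x\<bar>"])
    fix v assume v: "v \<in> {N a..N b}" "v \<noteq> x"
    have "norm (f v - f x) \<le> K * (v - x)\<^sup>2"
      using le[of "r x" "r v"] r[OF x] r[OF v(1)] by (simp add: f_def)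
    then show "norm (f v - f x - 0) / norm (v - x) \<le> K * \<bar>v - x\<bar>"
      using v by (simp add: divide_simps power2_eq_square mult.assoc)
  next
    show "((\<lambda>y. K * \<bar>y - x\<bar>) \<longlongrightarrow> 0) (at x within {N a..N b})"
      by (auto intro!: tendsto_eq_intros)
  qed (auto intro: bounded_linear_zero)
  then have "f (N a) = f (N b)"
    using has_derivative_zero_unique[of "{N a..N b}" f "N a" "N b"] Nab by auto
  then show ?thesis
    using sub[of "r (N a)" a] sub[of "r (N b)" b] r[of "N a"] r[of "N b"] ab Nab
    by (auto simp: f_def)
qed

text \<open>The hypotheses are the second-order form of \<open>dT = -T dM\<close> for a complex measure \<open>dM\<close>
  dominated by the atomless measure \<open>C dN\<close>.\<close>
lemma exp_solution_if_quadratic_increments: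
  fixes N :: "'a::linear_continuum_topology \<Rightarrow> real" and T M :: "'a \<Rightarrow> complex"
  assumes ab: "a \<le> b" and cont: "continuous_on {a..b} N"
    and mono: "\<And>s t. a \<le> s \<Longrightarrow> s \<le> t \<Longrightarrow> t \<le> b \<Longrightarrow> N s \<le> N t"
    and T_bound: "\<And>t. a \<le> t \<Longrightarrow> t \<le> b \<Longrightarrow> norm (T t) \<le> B"
    and M_incr: "\<And>s t. a \<le> s \<Longrightarrow> s \<le> t \<Longrightarrow> t \<le> b \<Longrightarrow> norm (M t - M s) \<le> C * (N t - N s)"
    and T_incr: "\<And>s t. a \<le> s \<Longrightarrow> s \<le> t \<Longrightarrow> t \<le> b \<Longrightarrow>
      norm (T t - T s + T s * (M t - M s)) \<le> C' * (N t - N s)\<^sup>2"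
    and M0: "M a = 0" and C: "C \<ge> 0"
  shows "T b * exp (M b) = T a"
proof -
  \<comment> \<open>\<open>c\<close> bounds every increment of \<open>M\<close>, and also
    \<open>M s\<close> itself since \<open>M a = 0\<close>. In \<open>K\<close> the outer
    \<open>exp c\<close> bounds \<open>exp (M s)\<close>, \<open>1 + c\<close> bounds
    \<open>1 - w\<close>, the two terms with \<open>C\<^sup>2\<close> come from the Taylor remainder
    of exp and from \<open>w\<^sup>2\<close>, and \<open>C' * exp c\<close> from
    \<open>R * exp w\<close>.\<close>
  define c where "c = C * (N b - N a)"
  define K where "K = exp c * (B * ((1 + c) * exp c * C\<^sup>2 + C\<^sup>2) + C' * exp c)"
  have "T b * exp (M b) = T a * exp (M a)"
  proof (rule constant_if_quadratic_increments[OF ab cont mono, where K = K])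
    fix s t assume st: "a \<le> s" "s \<le> t" "t \<le> b"
    define w where "w = M t - M s"
    define R where "R = T t - T s + T s * w"
    define D where "D = N t - N s"
    have D: "0 \<le> D" "D \<le> N b - N a"
      using mono[of s t] mono[of a s] mono[of t b] st order_trans[of a s t] order_trans[of s t b]
      by (auto simp: D_def)
    have "B \<ge> 0"
      by (rule order_trans[OF norm_ge_zero T_bound[of a]]) (use ab in auto)
    have c: "c \<ge> 0"
      using C D by (auto simp: c_def)
    have w: "norm w \<le> C * D"
      using M_incr[OF st] by (simp add: w_def D_def)
    have wc: "norm w \<le> c"
      using w D C mult_left_mono[of D "N b - N a" C] by (simp add: c_def)
    have w2: "(norm w)\<^sup>2 \<le> C\<^sup>2 * D\<^sup>2"
      using power_mono[OF w norm_ge_zero, of 2] by (simp add: power_mult_distrib)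
    have R: "norm R \<le> C' * D\<^sup>2"
      using T_incr[OF st] by (simp add: R_def w_def D_def)
    have ew: "norm (exp w) \<le> exp c"
      using wc norm_exp[of w] by (meson exp_le_cancel_iff order_trans)
    have "norm (exp w - 1 - w) \<le> exp \<bar>Re w\<bar> * (norm w)\<^sup>2"
      using Taylor_exp[of w 1] by (simp add: numeral_2_eq_2 diff_diff_eq)
    also have "\<dots> \<le> exp c * (C\<^sup>2 * D\<^sup>2)"
      using w2 wc abs_Re_le_cmod[of w] by (intro mult_mono) auto
    finally have e2: "norm (exp w - 1 - w) \<le> exp c * (C\<^sup>2 * D\<^sup>2)" .
    have "norm (M s) \<le> C * (N s - N a)"
      using M_incr[of a s] st M0 by auto
    also have "\<dots> \<le> c"
      unfolding c_def using C mono[of s b] st by (intro mult_left_mono) auto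
    finally have Ms: "norm (exp (M s)) \<le> exp c"
      using norm_exp[of "M s"] by (meson exp_le_cancel_iff order_trans)
    have T_t: "T t = T s * (1 - w) + R"
      by (simp add: R_def algebra_simps)
    \<comment> \<open>The first-order terms cancel because (1 - w)(1 + w) = 1 - w^2; each remaining
      term is of second order.\<close>
    have "T t * exp w - T s = T s * ((1 - w) * (exp w - 1 - w) - w\<^sup>2) + R * exp w"
      unfolding T_t by (simp add: algebra_simps power2_eq_square)
    also have "norm \<dots> \<le> norm (T s) * (norm (1 - w) * norm (exp w - 1 - w) + (norm w)\<^sup>2)
        + norm R * norm (exp w)"
      by (intro order_trans[OF norm_triangle_ineq] add_mono)
        (auto simp: norm_mult norm_power intro!: mult_left_mono order_trans[OF norm_triangle_ineq4])
    also have "\<dots> \<le> B * ((1 + c) * (exp c * (C\<^sup>2 * D\<^sup>2)) + C\<^sup>2 * D\<^sup>2) + C' * D\<^sup>2 * exp c"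
      using T_bound[of s] st wc c e2 w2 R ew \<open>B \<ge> 0\<close> norm_triangle_ineq4[of 1 w]
      by (intro add_mono mult_mono order_trans[OF norm_ge_zero R]) (auto intro!: add_nonneg_nonneg mult_nonneg_nonneg)
    also have "\<dots> = (B * ((1 + c) * exp c * C\<^sup>2 + C\<^sup>2) + C' * exp c) * D\<^sup>2"
      by (simp add: algebra_simps)
    finally have fin: "norm (T t * exp w - T s) \<le> \<dots>" .
    have "M t = M s + w"
      by (simp add: w_def)
    then have "T t * exp (M t) - T s * exp (M s) = exp (M s) * (T t * exp w - T s)"
      by (simp add: exp_add algebra_simps)
    then have "norm (T t * exp (M t) - T s * exp (M s)) = norm (exp (M s)) * norm (T t * exp w - T s)"
      by (simp add: norm_mult)
    also have "\<dots> \<le> exp c * ((B * ((1 + c) * exp c * C\<^sup>2 + C\<^sup>2) + C' * exp c) * D\<^sup>2)"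
      using Ms fin by (intro mult_mono) auto
    also have "\<dots> = K * (N t - N s)\<^sup>2"
      by (simp add: K_def D_def)
    finally show "norm (T t * exp (M t) - T s * exp (M s)) \<le> K * (N t - N s)\<^sup>2" .
  qed
  then show ?thesis
    by (simp add: M0)
qed

text \<open>A product majorant makes the double family absolutely summable, so rows and
  antidiagonals give the same total. It serves to split k points into j chosen ones and l = k - j
  others when \<open>f\<close> is not itself a product.\<close>

lemma suminf_antidiagonal:
  fixes f :: "nat \<Rightarrow> nat \<Rightarrow> 'a::banach"
  assumes bnd: "\<And>j l. norm (f j l) \<le> A j * B l" and A: "summable A" and B: "summable B"
    and nn: "\<And>j. 0 \<le> A j" "\<And>l. 0 \<le> B l"
  shows "(\<lambda>k. \<Sum>j\<le>k. f j (k - j)) sums (\<Sum>j. \<Sum>l. f j l)"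
    and "summable (\<lambda>j. \<Sum>l. f j l)"
proof -
  have A': "A summable_on UNIV" and B': "B summable_on UNIV"
    using A B nn by (simp_all add: summable_on_UNIV_nonneg_real_iff)
  have "(\<lambda>p. norm ((\<lambda>(j,l). A j * B l) p)) summable_on UNIV \<times> UNIV"
    unfolding Infinite_Sum.abs_summable_on_Sigma_iff
  proof (intro conjI ballI)
    show "(\<lambda>l. norm ((\<lambda>(j,l). A j * B l) (j, l))) summable_on UNIV" for j
      using B' nn by (simp add: abs_mult summable_on_cmult_right)
    show "(\<lambda>j. norm (infsum (\<lambda>l. norm ((\<lambda>(j,l). A j * B l) (j, l))) UNIV)) summable_on UNIV"
      using A' nn by (simp add: abs_mult infsum_cmult_right' infsum_nonneg summable_on_cmult_left)
  qed
  then have "(\<lambda>(j,l). A j * B l) summable_on UNIV \<times> UNIV"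
    by (rule abs_summable_summable)
  then have abs: "(\<lambda>p. norm (f (fst p) (snd p))) summable_on UNIV \<times> UNIV"
    by (rule summable_on_comparison_test) (auto simp: bnd)
  then have "(\<lambda>p. f (fst p) (snd p)) summable_on UNIV \<times> UNIV"
    by (rule abs_summable_summable)
  then obtain S where S: "((\<lambda>p. f (fst p) (snd p)) has_sum S) (UNIV \<times> UNIV)"
    by (auto simp: summable_on_def)
  have sl: "summable (\<lambda>l. norm (f j l))" for j
    by (rule summable_comparison_test'[of "\<lambda>l. A j * B l" 0]) (auto simp: bnd B intro!: summable_mult)
  then have row: "((\<lambda>l. f j l) has_sum (\<Sum>l. f j l)) UNIV" for j
    by (intro norm_summable_imp_has_sum summable_sums) (auto dest: summable_norm_cancel)
  have "((\<lambda>j. \<Sum>l. f j l) has_sum S) UNIV"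
    using has_sum_SigmaD[OF S] row by simp
  then have s1: "(\<lambda>j. \<Sum>l. f j l) sums S"
    by (rule has_sum_imp_sums)
  have "((\<lambda>p. f (snd p) (fst p - snd p)) has_sum S) (SIGMA k:UNIV. {..k})
      \<longleftrightarrow> ((\<lambda>p. f (fst p) (snd p)) has_sum S) (UNIV \<times> UNIV)"
    by (rule has_sum_reindex_bij_witness[where j = "\<lambda>(k,j). (j, k - j)" and i = "\<lambda>(j,l). (j + l, j)"]) auto
  with S have "((\<lambda>p. f (snd p) (fst p - snd p)) has_sum S) (SIGMA k:UNIV. {..k})"
    by blast
  then have "((\<lambda>k. \<Sum>j\<le>k. f j (k - j)) has_sum S) UNIV"
    by (rule has_sum_SigmaD) (auto intro!: has_sum_finite)
  then have s2: "(\<lambda>k. \<Sum>j\<le>k. f j (k - j)) sums S"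
    by (rule has_sum_imp_sums)
  from s1 s2 show "(\<lambda>k. \<Sum>j\<le>k. f j (k - j)) sums (\<Sum>j. \<Sum>l. f j l)" "summable (\<lambda>j. \<Sum>l. f j l)"
    by (auto simp: sums_iff)
qed

text \<open>The factors are switched on in increasing order of \<open>D\<close>. When S is reached,
  the product consists of the factors with smaller \<open>D\<close>, and it drops by (1 - p S) times
  that product. Injectivity ensures that each step switches on a single factor.\<close>

lemma one_minus_prod_telescope:
  fixes p :: "'b \<Rightarrow> 'c::comm_ring_1" and D :: "'b \<Rightarrow> 'd::linorder"
  assumes "finite B" "inj_on D B"
  shows "1 - prod p B = (\<Sum>S\<in>B. (1 - p S) * prod p {S'\<in>B. D S' < D S})"
  using assms
proof (induction B rule: finite_ranking_induct[where f = D])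
  case (insert x B)
  show ?case
  proof (cases "x \<in> B")
    case False
    have D: "D S < D x" if "S \<in> B" for S
      using insert.hyps(2)[OF that] insert.prems that False
      by (auto simp: less_le inj_on_def)
    have 1: "{S' \<in> insert x B. D S' < D x} = B"
      using D by auto
    have 2: "{S' \<in> insert x B. D S' < D S} = {S' \<in> B. D S' < D S}" if "S \<in> B" for S
      using D[OF that] by auto
    have "(\<Sum>S\<in>insert x B. (1 - p S) * prod p {S' \<in> insert x B. D S' < D S}) =
        (1 - p x) * prod p B + (\<Sum>S\<in>B. (1 - p S) * prod p {S' \<in> B. D S' < D S})"
      using insert.hyps(1) False by (simp add: 1 2 del: insert_iff cong: sum.cong)
    also have "\<dots> = (1 - p x) * prod p B + (1 - prod p B)"
      using insert.IH insert.prems by simp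
    finally show ?thesis
      using False insert.hyps(1) by (simp add: algebra_simps)
  qed (use insert in \<open>simp add: insert_absorb\<close>)
qed auto

lemma sum_Pow_by_card:
  fixes g :: "nat \<Rightarrow> 'b::comm_ring_1"
  shows "(\<Sum>S\<in>Pow {0..<k}. g (card S)) = (\<Sum>j\<le>k. of_nat (k choose j) * g j)"
proof -
  have "(\<Sum>S\<in>Pow {0..<k}. g (card S)) = (\<Sum>j\<in>{..k}. \<Sum>S\<in>{S\<in>Pow {0..<k}. card S = j}. g (card S))"
    by (rule sum.group[symmetric]) (auto dest: card_mono[rotated])
  also have "\<dots> = (\<Sum>j\<le>k. of_nat (k choose j) * g j)"
  proof (intro sum.cong refl)
    fix j
    have "card {S\<in>Pow {0..<k}. card S = j} = k choose j"
      using n_subsets[of "{0..<k}" j] by simp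
    then show "(\<Sum>S\<in>{S\<in>Pow {0..<k}. card S = j}. g (card S)) = of_nat (k choose j) * g j"
      by simp
  qed
  finally show ?thesis .
qed

section \<open>Splitting a configuration\<close>

lemma expm_nonneg: "0 \<le> expm v"
  by (simp add: expm_def)

lemma expm_le_1: "0 \<le> v \<Longrightarrow> expm v \<le> 1"
  by (auto simp: expm_def real_of_ereal_pos)

lemma expm_0: "expm 0 = 1"
  by (simp add: expm_def)

lemma expm_add: "0 \<le> a \<Longrightarrow> 0 \<le> b \<Longrightarrow> expm (a + b) = expm a * expm b"
  by (cases a; cases b) (auto simp: expm_def exp_add[symmetric])

lemma expm_sum:
  assumes "finite A" "\<And>a. a \<in> A \<Longrightarrow> 0 \<le> f a"
  shows "expm (sum f A) = (\<Prod>a\<in>A. expm (f a))"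
  using assms by (induction A rule: finite_induct) (auto simp: expm_0 expm_add sum_nonneg)

lemma measurable_expm [measurable]: "expm \<in> borel_measurable borel"
  unfolding expm_def by measurable

lemma length_tup [simp]: "length (tup k x) = k"
  by (simp add: tup_def)

lemma mset_nths_tup:
  assumes "S \<subseteq> {0..<k}"
  shows "mset (nths (tup k x) S) = image_mset x (mset_set S)"
proof -
  have "set (nths [0..<k] S) = S"
  proof (intro equalityI subsetI)
    fix i assume "i \<in> S"
    then have "i < length [0..<k]" "[0..<k] ! i = i"
      using assms by auto
    then show "i \<in> set (nths [0..<k] S)"
      unfolding set_nths using \<open>i \<in> S\<close> by (metis (mono_tags, lifting) mem_Collect_eq)
  qed (use assms in \<open>auto simp: set_nths\<close>)
  then have "mset (nths [0..<k] S) = mset_set S"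
    using mset_set_set[of "nths [0..<k] S"] by simp
  then show ?thesis
    by (simp add: tup_def nths_map)
qed

text \<open>A symmetric potential factors through multisets, which makes relabelled tuples
  comparable without tracking the order of their entries.\<close>

definition mset_pot :: "'a potential \<Rightarrow> 'a multiset \<Rightarrow> ereal" where
  "mset_pot \<psi> m = \<psi> (SOME xs. mset xs = m)"

lemma mset_pot: "symmetric_pot \<psi> \<Longrightarrow> \<psi> xs = mset_pot \<psi> (mset xs)"
  unfolding mset_pot_def symmetric_pot_def by (metis (mono_tags, lifting) someI)

lemma Ham_nonneg: "repulsive_pot \<psi> \<Longrightarrow> 0 \<le> Ham \<psi> xs"
  by (auto simp: Ham_def repulsive_pot_def intro!: sum_nonneg)

lemma repulsive_pin: "repulsive_pot \<psi> \<Longrightarrow> repulsive_pot (pin \<psi> ws)"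
  by (auto simp: pin_def repulsive_pot_def intro!: sum_nonneg)

lemma expm_Ham_tup:
  assumes "symmetric_pot \<psi>" "repulsive_pot \<psi>"
  shows "expm (Ham \<psi> (tup k x)) = (\<Prod>S\<in>Pow {0..<k} - {{}}. expm (mset_pot \<psi> (image_mset x (mset_set S))))"
proof -
  have "expm (Ham \<psi> (tup k x)) = (\<Prod>S\<in>Pow {0..<k} - {{}}. expm (\<psi> (nths (tup k x) S)))"
    using assms(2) by (simp add: Ham_def expm_sum repulsive_pot_def)
  also have "\<dots> = (\<Prod>S\<in>Pow {0..<k} - {{}}. expm (mset_pot \<psi> (image_mset x (mset_set S))))"
    using assms(1) by (intro prod.cong refl) (simp add: mset_pot mset_nths_tup)
  finally show ?thesis .
qed

lemma expm_Ham_pin_tup: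
  assumes "symmetric_pot \<psi>" "repulsive_pot \<psi>"
  shows "expm (Ham (pin \<psi> (tup j w)) (tup l v)) =
    (\<Prod>B\<in>Pow {0..<l} - {{}}. \<Prod>A\<in>Pow {0..<j}.
      expm (mset_pot \<psi> (image_mset w (mset_set A) + image_mset v (mset_set B))))"
proof -
  have "expm (Ham (pin \<psi> (tup j w)) (tup l v)) =
      (\<Prod>B\<in>Pow {0..<l} - {{}}. expm (pin \<psi> (tup j w) (nths (tup l v) B)))"
    using repulsive_pin[OF assms(2)] by (simp add: Ham_def expm_sum repulsive_pot_def)
  also have "\<dots> = (\<Prod>B\<in>Pow {0..<l} - {{}}. \<Prod>A\<in>Pow {0..<j}.
      expm (mset_pot \<psi> (image_mset w (mset_set A) + image_mset v (mset_set B))))"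
  proof (intro prod.cong refl)
    fix B assume B: "B \<in> Pow {0..<l} - {{}}"
    have "expm (pin \<psi> (tup j w) (nths (tup l v) B)) =
        (\<Prod>A\<in>Pow {0..<j}. expm (\<psi> (nths (tup l v) B @ nths (tup j w) A)))"
      using assms(2) by (simp add: pin_def expm_sum repulsive_pot_def)
    also have "\<dots> = (\<Prod>A\<in>Pow {0..<j}.
        expm (mset_pot \<psi> (image_mset w (mset_set A) + image_mset v (mset_set B))))"
      using assms(1) B by (intro prod.cong refl) (simp add: mset_pot mset_nths_tup add.commute)
    finally show "expm (pin \<psi> (tup j w) (nths (tup l v) B)) = \<dots>" .
  qed
  finally show ?thesis .
qed

text \<open>Inverse of splitting x into x_S and its complement. The bijections \<open>f\<close> and
  \<open>g\<close> need not respect the order of indices, since they are used with symmetric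
  potentials.\<close>

definition split_merge ::
    "nat \<Rightarrow> nat set \<Rightarrow> (nat \<Rightarrow> nat) \<Rightarrow> (nat \<Rightarrow> nat) \<Rightarrow> (nat \<Rightarrow> 'a) \<times> (nat \<Rightarrow> 'a) \<Rightarrow> nat \<Rightarrow> 'a" where
  "split_merge k S f g p = (\<lambda>i\<in>{..<k}. if i \<in> S then fst p (f i) else snd p (g i))"

lemma image_mset_split_merge:
  assumes S: "S \<subseteq> {0..<k}" and f: "bij_betw f S {0..<j}" and g: "bij_betw g ({0..<k} - S) {0..<l}"
    and C: "C \<subseteq> {0..<k}"
  shows "image_mset (split_merge k S f g (w, v)) (mset_set C) =
    image_mset w (mset_set (f ` (C \<inter> S))) + image_mset v (mset_set (g ` (C - S)))"
proof -
  have fin: "finite C"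
    using C finite_subset by blast
  have injf: "inj_on f (C \<inter> S)" and injg: "inj_on g (C - S)"
    using f g C by (auto simp: bij_betw_def intro: inj_on_subset)
  have "mset_set C = mset_set (C \<inter> S) + mset_set (C - S)"
    using fin by (subst mset_set_Union[symmetric]) (auto simp: Int_Diff_Un)
  then have "image_mset (split_merge k S f g (w, v)) (mset_set C) =
      image_mset (split_merge k S f g (w, v)) (mset_set (C \<inter> S)) +
      image_mset (split_merge k S f g (w, v)) (mset_set (C - S))"
    by simp
  also have "image_mset (split_merge k S f g (w, v)) (mset_set (C \<inter> S)) = image_mset (w \<circ> f) (mset_set (C \<inter> S))"
    using C fin by (intro image_mset_cong) (auto simp: split_merge_def)
  also have "\<dots> = image_mset w (mset_set (f ` (C \<inter> S)))"
    using injf by (simp add: image_mset_mset_set[symmetric] multiset.map_comp)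
  also have "image_mset (split_merge k S f g (w, v)) (mset_set (C - S)) = image_mset (v \<circ> g) (mset_set (C - S))"
    using C fin by (intro image_mset_cong) (auto simp: split_merge_def)
  also have "\<dots> = image_mset v (mset_set (g ` (C - S)))"
    using injg by (simp add: image_mset_mset_set[symmetric] multiset.map_comp)
  finally show ?thesis .
qed

text \<open>A nonempty C corresponds to the pair (g(C - S), f(C \<inter> S)) = (B, A), which is not
  the pair of empty sets. The pairs with B empty give the Hamiltonian of w; for each nonempty B, the
  product over all A is the factor of the potential pinned at w.\<close>

lemma expm_Ham_split_merge:
  assumes \<psi>: "symmetric_pot \<psi>" "repulsive_pot \<psi>"
    and S: "S \<subseteq> {0..<k}" and f: "bij_betw f S {0..<j}" and g: "bij_betw g ({0..<k} - S) {0..<l}"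
  shows "expm (Ham \<psi> (tup k (split_merge k S f g (w, v)))) =
    expm (Ham \<psi> (tup j w)) * expm (Ham (pin \<psi> (tup j w)) (tup l v))"
proof -
  define F where "F A B = expm (mset_pot \<psi> (image_mset w (mset_set A) + image_mset v (mset_set B)))" for A B
  define h where "h C = (g ` (C - S), f ` (C \<inter> S))" for C
  define R where "R = (SIGMA B:Pow {0..<l}. Pow {0..<j})"
  have inj: "inj_on h (Pow {0..<k})"
  proof (rule inj_onI)
    fix C D assume C: "C \<in> Pow {0..<k}" and D: "D \<in> Pow {0..<k}" and "h C = h D"
    then have "g ` (C - S) = g ` (D - S)" "f ` (C \<inter> S) = f ` (D \<inter> S)"
      by (auto simp: h_def)
    then have "C - S = D - S" "C \<inter> S = D \<inter> S"
      using C D inj_on_image_eq_iff[OF bij_betw_imp_inj_on[OF g], of "C - S" "D - S"]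
        inj_on_image_eq_iff[OF bij_betw_imp_inj_on[OF f], of "C \<inter> S" "D \<inter> S"] by auto
    then show "C = D"
      by blast
  qed
  have "h ` Pow {0..<k} = R"
  proof (intro equalityI subsetI)
    fix p assume "p \<in> h ` Pow {0..<k}"
    then show "p \<in> R"
      using bij_betw_imp_surj_on[OF f] bij_betw_imp_surj_on[OF g] by (fastforce simp: h_def R_def)
  next
    fix p assume "p \<in> R"
    then obtain B A where BA: "p = (B, A)" "B \<subseteq> {0..<l}" "A \<subseteq> {0..<j}"
      by (auto simp: R_def)
    define A' where "A' = {i\<in>S. f i \<in> A}"
    define B' where "B' = {i\<in>{0..<k} - S. g i \<in> B}"
    have "f ` A' = f ` S \<inter> A" "g ` B' = g ` ({0..<k} - S) \<inter> B"
      by (auto simp: A'_def B'_def)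
    then have "f ` A' = A" "g ` B' = B"
      using BA bij_betw_imp_surj_on[OF f] bij_betw_imp_surj_on[OF g] by auto
    moreover have "(A' \<union> B') \<inter> S = A'" "(A' \<union> B') - S = B'" "A' \<union> B' \<subseteq> {0..<k}"
      using S by (auto simp: A'_def B'_def)
    ultimately show "p \<in> h ` Pow {0..<k}"
      by (intro image_eqI[of _ _ "A' \<union> B'"]) (auto simp: h_def BA)
  qed
  then have "bij_betw h (Pow {0..<k} - {{}}) (R - {({}, {})})"
    using inj by (intro bij_betw_DiffI) (auto simp: bij_betw_def h_def)
  then have "(\<Prod>C\<in>Pow {0..<k} - {{}}. F (snd (h C)) (fst (h C))) = (\<Prod>p\<in>R - {({}, {})}. F (snd p) (fst p))"
    by (rule prod.reindex_bij_betw)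
  also have "R - {({}, {})} = {{}} \<times> (Pow {0..<j} - {{}}) \<union> (SIGMA B:Pow {0..<l} - {{}}. Pow {0..<j})"
    by (auto simp: R_def)
  also have "(\<Prod>p\<in>\<dots>. F (snd p) (fst p)) =
      (\<Prod>p\<in>{{}} \<times> (Pow {0..<j} - {{}}). F (snd p) (fst p)) *
      (\<Prod>p\<in>(SIGMA B:Pow {0..<l} - {{}}. Pow {0..<j}). F (snd p) (fst p))"
    by (rule prod.union_disjoint) auto
  also have "(\<Prod>p\<in>{{}} \<times> (Pow {0..<j} - {{}}). F (snd p) (fst p)) = (\<Prod>A\<in>Pow {0..<j} - {{}}. F A {})"
    using prod.Sigma[of "{{}}" "\<lambda>_. Pow {0..<j} - {{}}" "\<lambda>B A. F A B"]
    by (simp add: case_prod_beta)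
  also have "(\<Prod>p\<in>(SIGMA B:Pow {0..<l} - {{}}. Pow {0..<j}). F (snd p) (fst p)) =
      (\<Prod>B\<in>Pow {0..<l} - {{}}. \<Prod>A\<in>Pow {0..<j}. F A B)"
    using prod.Sigma[of "Pow {0..<l} - {{}}" "\<lambda>_. Pow {0..<j}" "\<lambda>B A. F A B"]
    by (simp add: case_prod_beta)
  finally have "(\<Prod>C\<in>Pow {0..<k} - {{}}. F (f ` (C \<inter> S)) (g ` (C - S))) =
      (\<Prod>A\<in>Pow {0..<j} - {{}}. F A {}) * (\<Prod>B\<in>Pow {0..<l} - {{}}. \<Prod>A\<in>Pow {0..<j}. F A B)"
    by (simp add: h_def)
  moreover have "expm (Ham \<psi> (tup k (split_merge k S f g (w, v)))) =
      (\<Prod>C\<in>Pow {0..<k} - {{}}. F (f ` (C \<inter> S)) (g ` (C - S)))"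
    unfolding expm_Ham_tup[OF \<psi>] F_def
    by (intro prod.cong refl) (simp add: image_mset_split_merge[OF S f g])
  ultimately show ?thesis
    unfolding expm_Ham_tup[OF \<psi>] expm_Ham_pin_tup[OF \<psi>] by (simp add: F_def)
qed

lemma measurable_split_merge [measurable]:
  assumes S: "S \<subseteq> {0..<k}" and f: "bij_betw f S {0..<j}" and g: "bij_betw g ({0..<k} - S) {0..<l}"
  shows "split_merge k S f g \<in> PiM {..<j} (\<lambda>_. R) \<Otimes>\<^sub>M PiM {..<l} (\<lambda>_. R) \<rightarrow>\<^sub>M PiM {..<k} (\<lambda>_. R)"
  unfolding split_merge_def
proof (rule measurable_restrict)
  fix i assume i: "i \<in> {..<k}"
  show "(\<lambda>p. if i \<in> S then fst p (f i) else snd p (g i)) \<in> PiM {..<j} (\<lambda>_. R) \<Otimes>\<^sub>M PiM {..<l} (\<lambda>_. R) \<rightarrow>\<^sub>M R"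
  proof (cases "i \<in> S")
    case True
    then have "f i \<in> {..<j}"
      using f by (auto simp: bij_betw_def)
    then have "(\<lambda>p. fst p (f i)) \<in> PiM {..<j} (\<lambda>_. R) \<Otimes>\<^sub>M PiM {..<l} (\<lambda>_. R) \<rightarrow>\<^sub>M R"
      by measurable
    then show ?thesis
      using True by simp
  next
    case False
    then have "g i \<in> {..<l}"
      using g i by (auto simp: bij_betw_def)
    then have "(\<lambda>p. snd p (g i)) \<in> PiM {..<j} (\<lambda>_. R) \<Otimes>\<^sub>M PiM {..<l} (\<lambda>_. R) \<rightarrow>\<^sub>M R"
      by measurable
    then show ?thesis
      using False by simp
  qed
qed

text \<open>All coordinates carry the same measure, so relabelling preserves the product measure. It
  suffices to compare boxes.\<close>

lemma distr_split_merge: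
  assumes R: "sigma_finite_measure R"
    and S: "S \<subseteq> {0..<k}" and f: "bij_betw f S {0..<j}" and g: "bij_betw g ({0..<k} - S) {0..<l}"
  shows "distr (PiM {..<j} (\<lambda>_. R) \<Otimes>\<^sub>M PiM {..<l} (\<lambda>_. R)) (PiM {..<k} (\<lambda>_. R)) (split_merge k S f g)
    = PiM {..<k} (\<lambda>_. R)"
proof -
  interpret product_sigma_finite "\<lambda>_::nat. R"
    using R by (simp add: product_sigma_finite_def)
  interpret J: finite_product_sigma_finite "\<lambda>_::nat. R" "{..<j}" by standard simp
  interpret L: finite_product_sigma_finite "\<lambda>_::nat. R" "{..<l}" by standard simp
  show ?thesis
  proof (rule PiM_eqI)
    fix A :: "nat \<Rightarrow> _" assume A: "\<And>i. i \<in> {..<k} \<Longrightarrow> A i \<in> sets R"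
    define Af where "Af = (\<lambda>i. A (inv_into S f i))"
    define Ag where "Ag = (\<lambda>i. A (inv_into ({0..<k} - S) g i))"
    have fS: "f i < j" "Af (f i) = A i" if "i \<in> S" for i
      using that f by (auto simp: Af_def bij_betw_def)
    have gS: "g i < l" "Ag (g i) = A i" if "i < k" "i \<notin> S" for i
      using that g by (auto simp: Ag_def bij_betw_def)
    have fS': "\<exists>i. i \<in> S \<and> a = f i" if "a < j" for a
      using that bij_betw_imp_surj_on[OF f] by (metis atLeastLessThan_iff imageE le0)
    have gS': "\<exists>i. i < k \<and> i \<notin> S \<and> a = g i" if "a < l" for a
    proof -
      have "a \<in> g ` ({0..<k} - S)"
        using that bij_betw_imp_surj_on[OF g] by simp
      then show ?thesis
        by auto
    qed
    have sub: "A i \<subseteq> space R" if "i < k" for i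
      using A[THEN sets.sets_into_space, of i] that by simp
    have Sk: "i < k" if "i \<in> S" for i
      using S that by auto
    have Af: "Af i \<in> sets R" if "i < j" for i
      using fS'[OF that] fS A Sk by auto
    have Ag: "Ag i \<in> sets R" if "i < l" for i
      using gS'[OF that] gS A by auto
    \<comment> \<open>The preimage of a box is a product of two boxes, whose sides are those of
      \<open>A\<close> transported along the inverses of \<open>f\<close> and
      \<open>g\<close>.\<close>
    have *: "split_merge k S f g -` Pi\<^sub>E {..<k} A \<inter> space (PiM {..<j} (\<lambda>_. R) \<Otimes>\<^sub>M PiM {..<l} (\<lambda>_. R))
        = Pi\<^sub>E {..<j} Af \<times> Pi\<^sub>E {..<l} Ag" (is "?L = ?R")
    proof (rule set_eqI, clarify)
      fix w v
      have "(\<forall>i<k. (if i \<in> S then w (f i) else v (g i)) \<in> A i) \<longleftrightarrow>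
          (\<forall>a<j. w a \<in> Af a) \<and> (\<forall>a<l. v a \<in> Ag a)" (is "?l \<longleftrightarrow> ?r")
      proof
        assume ?l
        show ?r
        proof safe
          fix a assume "a < j"
          then obtain i where "i \<in> S" "a = f i" using fS' by blast
          then show "w a \<in> Af a" using \<open>?l\<close>[rule_format, of i] fS Sk by auto
        next
          fix a assume "a < l"
          then obtain i where "i < k" "i \<notin> S" "a = g i" using gS' by blast
          then show "v a \<in> Ag a" using \<open>?l\<close>[rule_format, of i] gS by auto
        qed
      next
        assume ?r
        then show ?l
          using fS gS by (metis (full_types))
      qed
      moreover have "(\<forall>a<j. w a \<in> Af a) \<Longrightarrow> (\<forall>a<j. w a \<in> space R)"
        using Af[THEN sets.sets_into_space] by blast
      moreover have "(\<forall>a<l. v a \<in> Ag a) \<Longrightarrow> (\<forall>a<l. v a \<in> space R)"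
        using Ag[THEN sets.sets_into_space] by blast
      moreover have "(w, v) \<in> ?L \<longleftrightarrow> ?l \<and> (\<forall>a<j. w a \<in> space R) \<and> (\<forall>a<l. v a \<in> space R) \<and>
          w \<in> extensional {..<j} \<and> v \<in> extensional {..<l}"
        by (auto simp: split_merge_def space_pair_measure space_PiM PiE_iff Ball_def)
      moreover have "(w, v) \<in> ?R \<longleftrightarrow> ?r \<and> w \<in> extensional {..<j} \<and> v \<in> extensional {..<l}"
        by (auto simp: PiE_iff)
      ultimately show "(w, v) \<in> ?L \<longleftrightarrow> (w, v) \<in> ?R"
        by argo
    qed
    have "emeasure (distr (PiM {..<j} (\<lambda>_. R) \<Otimes>\<^sub>M PiM {..<l} (\<lambda>_. R)) (PiM {..<k} (\<lambda>_. R)) (split_merge k S f g)) (Pi\<^sub>E {..<k} A)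
        = emeasure (PiM {..<j} (\<lambda>_. R) \<Otimes>\<^sub>M PiM {..<l} (\<lambda>_. R)) (Pi\<^sub>E {..<j} Af \<times> Pi\<^sub>E {..<l} Ag)"
      using A by (subst emeasure_distr[OF measurable_split_merge[OF S f g]]) (auto simp: * intro!: sets_PiM_I_finite)
    also have "\<dots> = (\<Prod>i<j. emeasure R (Af i)) * (\<Prod>i<l. emeasure R (Ag i))"
      using Af Ag J.measure_times[of Af] L.measure_times[of Ag]
      by (subst L.emeasure_pair_measure_Times) (auto intro!: sets_PiM_I_finite)
    also have "(\<Prod>i<j. emeasure R (Af i)) = (\<Prod>i\<in>S. emeasure R (A i))"
      using prod.reindex_bij_betw[OF f, of "\<lambda>i. emeasure R (Af i)"] fS by (simp add: atLeast0LessThan)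
    also have "(\<Prod>i<l. emeasure R (Ag i)) = (\<Prod>i\<in>{0..<k} - S. emeasure R (A i))"
      using prod.reindex_bij_betw[OF g, of "\<lambda>i. emeasure R (Ag i)"] gS by (simp add: atLeast0LessThan)
    also have "(\<Prod>i\<in>S. emeasure R (A i)) * \<dots> = (\<Prod>i<k. emeasure R (A i))"
      using prod.subset_diff[of S "{0..<k}" "\<lambda>i. emeasure R (A i)"] S
      by (simp add: atLeast0LessThan mult.commute)
    finally show "emeasure (distr (PiM {..<j} (\<lambda>_. R) \<Otimes>\<^sub>M PiM {..<l} (\<lambda>_. R)) (PiM {..<k} (\<lambda>_. R)) (split_merge k S f g)) (Pi\<^sub>E {..<k} A)
        = (\<Prod>i<k. emeasure R (A i))" .
  qed simp_all
qed

section \<open>Partially pinned partition functions\<close>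

lemma pin_singleton: "pin \<phi> [y] xs = \<phi> xs + \<phi> (xs @ [y])"
proof -
  have "Pow {0..<length [y]} = {{}, {0}}"
    by auto
  then show ?thesis
    by (simp add: pin_def)
qed

lemma pin_Nil: "pin \<phi> [] = \<phi>"
  by (simp add: pin_def fun_eq_iff)

lemma Dz_nonneg: "0 \<le> Dz z xs"
  by (induction xs) (auto simp: Dz_def)

lemma Dz_mset: "Dz z xs = (\<Sum>x\<in>#mset xs. dist z x)"
  by (simp add: Dz_def sum_mset_sum_list[symmetric])

lemma Dz_nths_tup:
  assumes "S \<subseteq> {0..<k}"
  shows "Dz z (nths (tup k x) S) = (\<Sum>i\<in>S. dist z (x i))"
  using assms by (simp add: Dz_mset mset_nths_tup multiset.map_comp o_def sum_unfold_sum_mset)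

lemma Dz_tup: "Dz z (tup k x) = (\<Sum>i<k. dist z (x i))"
  by (simp add: Dz_def tup_def o_def sum_list_sum_nth atLeast0LessThan)

lemma symmetric_ppin:
  assumes "symmetric_pot \<phi>"
  shows "symmetric_pot (ppin z \<phi> y t)"
  unfolding symmetric_pot_def
proof (intro allI impI)
  fix xs ys :: "'a list" assume eq: "mset xs = mset ys"
  then have "mset (xs @ [y]) = mset (ys @ [y])"
    by simp
  then have "\<phi> (xs @ [y]) = \<phi> (ys @ [y])" "\<phi> xs = \<phi> ys"
    using assms eq unfolding symmetric_pot_def by blast+
  then show "ppin z \<phi> y t xs = ppin z \<phi> y t ys"
    using eq by (simp add: ppin_def pin_singleton Dz_mset)
qed

lemma repulsive_ppin: "repulsive_pot \<phi> \<Longrightarrow> repulsive_pot (ppin z \<phi> y t)"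
  using repulsive_pin[of \<phi> "[y]"] by (simp add: repulsive_pot_def ppin_def)

lemma ppin_0: "ppin z \<phi> y 0 = \<phi>"
proof -
  have "\<not> ereal (Dz z xs) < 0" for xs
    using Dz_nonneg[of z xs] by (simp add: not_less)
  then show ?thesis
    by (simp add: ppin_def)
qed

lemma ppin_PInf: "ppin z \<phi> y \<infinity> = pin \<phi> [y]"
  by (simp add: ppin_def fun_eq_iff)

text \<open>One potential and one point y are fixed. The collection enters through the lower bound
  along the path \<open>ppin z \<phi> y t\<close>, Assumption (A) through the nullity of the spheres
  about z, and boundedness of \<Lambda> through its finite mass.\<close>

locale partially_pinned_gas =
  fixes \<nu> :: "('a::polish_space) measure" and \<Lambda> :: "'a set" and z :: 'a
    and \<phi> :: "'a potential" and y :: 'a and lam :: complex and \<delta> :: real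
  assumes sets_nu: "sets \<nu> = sets borel"
    and Lam_sets: "\<Lambda> \<in> sets \<nu>"
    and Lam_finite: "emeasure \<nu> \<Lambda> < \<infinity>"
    and sphere_null: "\<And>r. emeasure \<nu> {x. dist z x = r} = 0"
    and potential: "is_potential \<nu> \<phi>"
    and sym: "symmetric_pot \<phi>"
    and rep: "repulsive_pot \<phi>"
    and delta_pos: "0 < \<delta>"
    and zero_free: "\<And>t. 0 \<le> t \<Longrightarrow> \<delta> \<le> norm (Zpart \<nu> \<Lambda> (ppin z \<phi> y t) lam)"
begin

abbreviation "R \<equiv> restrict_space \<nu> \<Lambda>"
abbreviation "P \<equiv> nuL \<nu> \<Lambda>"
abbreviation "psi \<equiv> ppin z \<phi> y"
abbreviation "V \<equiv> measure \<nu> \<Lambda>"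
abbreviation "D k x \<equiv> Dz z (tup k x)"

lemma space_nu: "space \<nu> = UNIV"
  using sets_eq_imp_space_eq[OF sets_nu] by simp

lemma finite_R: "finite_measure R"
  using Lam_sets Lam_finite
  by (intro finite_measureI) (auto simp: space_restrict_space emeasure_restrict_space space_nu)

sublocale R: finite_measure R
  by (rule finite_R)

sublocale R: product_sigma_finite "\<lambda>_::nat. R"
  by (simp add: product_sigma_finite_def R.sigma_finite_measure_axioms)

lemma emeasure_P: "emeasure (P k) (space (P k)) = ennreal (V ^ k)"
proof -
  interpret F: finite_product_sigma_finite "\<lambda>_::nat. R" "{..<k}"
    by standard simp
  have "emeasure R (space R) = ennreal V"
    using Lam_sets Lam_finite
    by (simp add: emeasure_restrict_space space_restrict_space space_nu emeasure_eq_ennreal_measure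
        measure_restrict_space less_top)
  then show ?thesis
    using F.measure_times[of "\<lambda>_. space R"] by (simp add: nuL_def space_PiM ennreal_power)
qed

lemma finite_P: "finite_measure (P k)"
  by (rule finite_measureI) (simp add: emeasure_P)

sublocale P: finite_measure "P k" for k
  by (rule finite_P)

lemma measure_P: "measure (P k) (space (P k)) = V ^ k"
  by (simp add: measure_def emeasure_P)

section \<open>Measurability of potentials and Boltzmann factors\<close>

lemma component_P [measurable (raw)]: "i < k \<Longrightarrow> (\<lambda>x. x i) \<in> P k \<rightarrow>\<^sub>M \<nu>"
proof -
  assume "i < k"
  then have "(\<lambda>x. x i) \<in> P k \<rightarrow>\<^sub>M R"
    unfolding nuL_def by (intro measurable_component_singleton) simp
  then show ?thesis
    using measurable_comp[OF _ measurable_restrict_space1[OF measurable_ident], of _ "P k" \<nu> \<Lambda>]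
    by (simp add: o_def id_def)
qed

lemma measurable_dist_z [measurable]: "dist z \<in> borel_measurable \<nu>"
  by (subst measurable_cong_sets[OF sets_nu refl]) (intro borel_measurable_continuous_onI continuous_intros)

text \<open>A list of measurable maps into \<nu> covers subtuples, tuples extended by the constant
  y, and tuples drawn from both halves of a pair (w, v) in one statement.\<close>

lemma measurable_phi:
  assumes "\<And>f. f \<in> set fs \<Longrightarrow> f \<in> \<Omega> \<rightarrow>\<^sub>M \<nu>"
  shows "(\<lambda>m. \<phi> (map (\<lambda>f. f m) fs)) \<in> borel_measurable \<Omega>"
proof -
  define n where "n = length fs"
  have "(\<lambda>m. \<lambda>i\<in>{..<n}. (fs ! i) m) \<in> \<Omega> \<rightarrow>\<^sub>M PiM {..<n} (\<lambda>_. \<nu>)"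
    using assms by (intro measurable_restrict) (auto simp: n_def)
  moreover have "(\<lambda>x. \<phi> (tup n x)) \<in> borel_measurable (PiM {..<n} (\<lambda>_. \<nu>))"
    using potential by (simp add: is_potential_def)
  ultimately have "(\<lambda>m. \<phi> (tup n (\<lambda>i\<in>{..<n}. (fs ! i) m))) \<in> borel_measurable \<Omega>"
    by (rule measurable_compose)
  moreover have "tup n (\<lambda>i\<in>{..<n}. (fs ! i) m) = map (\<lambda>f. f m) fs" for m
    by (rule nth_equalityI) (auto simp: tup_def n_def)
  ultimately show ?thesis
    by simp
qed

lemma measurable_Dz:
  assumes "\<And>f. f \<in> set fs \<Longrightarrow> f \<in> \<Omega> \<rightarrow>\<^sub>M \<nu>"
  shows "(\<lambda>m. Dz z (map (\<lambda>f. f m) fs)) \<in> borel_measurable \<Omega>"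
  using assms
proof (induction fs)
  case (Cons f fs)
  then have "(\<lambda>m. Dz z (map (\<lambda>f. f m) fs)) \<in> borel_measurable \<Omega>" "(\<lambda>m. dist z (f m)) \<in> borel_measurable \<Omega>"
    by (auto intro: measurable_compose[OF _ measurable_dist_z])
  then show ?case
    by (simp add: Dz_def)
qed (simp add: Dz_def)

text \<open>The time is a function of the sample point, because the pinning at D(w) moves with
  w.\<close>

lemma measurable_psi:
  assumes fs: "\<And>f. f \<in> set fs \<Longrightarrow> f \<in> \<Omega> \<rightarrow>\<^sub>M \<nu>" and [measurable]: "\<tau> \<in> borel_measurable \<Omega>"
  shows "(\<lambda>m. psi (\<tau> m) (map (\<lambda>f. f m) fs)) \<in> borel_measurable \<Omega>"
proof -
  note [measurable] = measurable_Dz[OF fs] measurable_phi[OF fs]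
  have [measurable]: "(\<lambda>m. \<phi> (map (\<lambda>f. f m) fs @ [y])) \<in> borel_measurable \<Omega>"
    using measurable_phi[of "fs @ [\<lambda>_. y]" \<Omega>] fs by (force simp: space_nu)
  show ?thesis
    unfolding ppin_def pin_singleton by measurable
qed

lemma measurable_expm_Ham:
  assumes fs: "\<And>f. f \<in> set fs \<Longrightarrow> f \<in> \<Omega> \<rightarrow>\<^sub>M \<nu>" and gs: "\<And>f. f \<in> set gs \<Longrightarrow> f \<in> \<Omega> \<rightarrow>\<^sub>M \<nu>"
    and \<tau>: "\<tau> \<in> borel_measurable \<Omega>"
  shows "(\<lambda>m. expm (Ham (pin (psi (\<tau> m)) (map (\<lambda>f. f m) fs)) (map (\<lambda>f. f m) gs))) \<in> borel_measurable \<Omega>"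
proof -
  have "(\<lambda>m. psi (\<tau> m) (map (\<lambda>f. f m) (nths gs S) @ map (\<lambda>f. f m) (nths fs S'))) \<in> borel_measurable \<Omega>" for S S'
    unfolding map_append[symmetric]
    using fs gs by (intro measurable_psi[OF _ \<tau>]) (auto dest: in_set_nthsD)
  then have "(\<lambda>m. Ham (pin (psi (\<tau> m)) (map (\<lambda>f. f m) fs)) (map (\<lambda>f. f m) gs)) \<in> borel_measurable \<Omega>"
    unfolding Ham_def pin_def nths_map length_map by (intro borel_measurable_ereal_sum)
  then show ?thesis
    by (rule measurable_compose[OF _ measurable_expm])
qed

lemma tup_eq_map: "tup k x = map (\<lambda>f. f x) (map (\<lambda>i x. x i) [0..<k])"
  by (simp add: tup_def o_def)

lemma measurable_D [measurable]: "(\<lambda>x. D k x) \<in> borel_measurable (P k)"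
  unfolding tup_eq_map by (rule measurable_Dz) auto

lemma measurable_phi_y [measurable]: "(\<lambda>x. \<phi> (y # tup k x)) \<in> borel_measurable (P k)"
proof -
  have "(\<lambda>x. \<phi> (map (\<lambda>f. f x) ((\<lambda>_. y) # map (\<lambda>i x. x i) [0..<k]))) \<in> borel_measurable (P k)"
    by (rule measurable_phi) (auto simp: space_nu)
  then show ?thesis
    by (simp add: tup_eq_map o_def)
qed

lemma measurable_expm_Ham_psi [measurable (raw)]:
  assumes \<tau>: "\<tau> \<in> borel_measurable (P k)"
  shows "(\<lambda>x. expm (Ham (psi (\<tau> x)) (tup k x))) \<in> borel_measurable (P k)"
proof -
  have "f \<in> P k \<rightarrow>\<^sub>M \<nu>" if "f \<in> set (map (\<lambda>i x. x i) [0..<k])" for f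
    using that by auto
  from measurable_expm_Ham[of "[]" "P k" "map (\<lambda>i x. x i) [0..<k]", OF _ this \<tau>] show ?thesis
    by (simp add: pin_Nil tup_def o_def)
qed

lemma measurable_expm_Ham_psi_pair [measurable (raw)]:
  "(\<lambda>p. expm (Ham (psi (ereal (D j (fst p)))) (tup l (snd p)))) \<in> borel_measurable (P j \<Otimes>\<^sub>M P l)"
proof -
  have 1: "(\<lambda>p. ereal (D j (fst p))) \<in> borel_measurable (P j \<Otimes>\<^sub>M P l)"
    by measurable
  have "f \<in> P j \<Otimes>\<^sub>M P l \<rightarrow>\<^sub>M \<nu>" if "f \<in> set (map (\<lambda>i p. snd p i) [0..<l])" for f
    using that by (auto intro: measurable_compose[OF measurable_snd component_P])
  from measurable_expm_Ham[of "[]" _ "map (\<lambda>i p. snd p i) [0..<l]", OF _ this 1] show ?thesis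
    by (simp add: pin_Nil tup_def o_def)
qed

lemma measurable_expm_Ham_pin [measurable (raw)]:
  "(\<lambda>p. expm (Ham (pin (psi (ereal (D j (fst p)))) (tup j (fst p))) (tup l (snd p))))
    \<in> borel_measurable (P j \<Otimes>\<^sub>M P l)"
proof -
  have 1: "(\<lambda>p. ereal (D j (fst p))) \<in> borel_measurable (P j \<Otimes>\<^sub>M P l)"
    by measurable
  have 2: "f \<in> P j \<Otimes>\<^sub>M P l \<rightarrow>\<^sub>M \<nu>" if "f \<in> set (map (\<lambda>i p. snd p i) [0..<l])" for f
    using that by (auto intro: measurable_compose[OF measurable_snd component_P])
  have 3: "f \<in> P j \<Otimes>\<^sub>M P l \<rightarrow>\<^sub>M \<nu>" if "f \<in> set (map (\<lambda>i p. fst p i) [0..<j])" for f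
    using that by (auto intro: measurable_compose[OF measurable_fst component_P])
  from measurable_expm_Ham[of "map (\<lambda>i p. fst p i) [0..<j]" _ "map (\<lambda>i p. snd p i) [0..<l]", OF 3 2 1] show ?thesis
    by (simp add: tup_def o_def)
qed

section \<open>Almost sure distinctness of the values D(x_S)\<close>

lemma AE_dist_neq:
  assumes i: "i < k" and [measurable]: "h \<in> borel_measurable (P k)" and h: "\<And>x v. h (x(i := v)) = h x"
  shows "AE x in P k. dist z (x i) \<noteq> (h x :: real)"
proof -
  define A where "A = {x\<in>space (P k). dist z (x i) = h x}"
  define I where "I = {..<k} - {i}"
  have I: "insert i I = {..<k}" "finite I" "i \<notin> I"
    using i by (auto simp: I_def)
  have [measurable]: "(\<lambda>x. dist z (x i)) \<in> borel_measurable (P k)"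
    using component_P[OF i] by (rule measurable_compose[OF _ measurable_dist_z])
  have A: "A \<in> sets (P k)"
    unfolding A_def by measurable
  have sphere: "{v\<in>space R. dist z v = r} \<in> null_sets R" for r
  proof -
    have "{v. dist z v = r} \<in> sets \<nu>"
      using measurable_sets[OF measurable_dist_z, of "{r}"] by (simp add: vimage_def space_nu)
    then have "{v. dist z v = r} \<in> null_sets \<nu>"
      using sphere_null by (auto simp: null_sets_def)
    then have "\<Lambda> \<inter> {v. dist z v = r} \<in> null_sets \<nu>"
      using Lam_sets by (rule null_set_Int1)
    then have "\<Lambda> \<inter> {v. dist z v = r} \<in> null_sets R"
      using Lam_sets by (subst null_sets_restrict_space) (auto simp: space_nu)
    then show ?thesis
      by (simp add: space_restrict_space space_nu Int_def)
  qed
  have "emeasure (P k) A = (\<integral>\<^sup>+x. indicator A x \<partial>PiM (insert i I) (\<lambda>_. R))"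
    using A by (simp add: I nuL_def)
  \<comment> \<open>Coordinate i is integrated first. With the other coordinates frozen,
    \<open>h\<close> does not change with it, so the slice of \<open>A\<close> lies in a null sphere
    about z.\<close>
  also have "\<dots> = (\<integral>\<^sup>+x. \<integral>\<^sup>+v. indicator A (x(i := v)) \<partial>R \<partial>PiM I (\<lambda>_. R))"
    using I A by (intro R.product_nn_integral_insert) (auto simp: nuL_def)
  also have "\<dots> = (\<integral>\<^sup>+x. 0 \<partial>PiM I (\<lambda>_. R))"
  proof (intro nn_integral_cong)
    fix x
    have "(\<integral>\<^sup>+v. indicator A (x(i := v)) \<partial>R) \<le> (\<integral>\<^sup>+v. indicator {v\<in>space R. dist z v = h x} v \<partial>R)"
      by (intro nn_integral_mono) (auto simp: indicator_def A_def h)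
    also have "\<dots> = 0"
      using sphere[of "h x"] by (auto simp: null_sets_def)
    finally show "(\<integral>\<^sup>+v. indicator A (x(i := v)) \<partial>R) = 0"
      by simp
  qed
  finally have "A \<in> null_sets (P k)"
    using A by (auto simp: null_sets_def)
  then show ?thesis
    by (rule AE_I') (auto simp: A_def)
qed

lemma measurable_sum_dist [measurable]:
  "S \<subseteq> {0..<k} \<Longrightarrow> (\<lambda>x. \<Sum>i\<in>S. dist z (x i)) \<in> borel_measurable (P k)"
  by (intro borel_measurable_sum measurable_compose[OF component_P measurable_dist_z]) auto

lemma AE_sum_dist_neq:
  assumes S: "S \<subseteq> {0..<k}" and S': "S' \<subseteq> {0..<k}" and neq: "i \<in> S" "i \<notin> S'"
  shows "AE x in P k. (\<Sum>j\<in>S. dist z (x j)) \<noteq> (\<Sum>j\<in>S'. dist z (x j)) + c"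
proof -
  have fin: "finite S"
    using S finite_subset by blast
  have [measurable]: "(\<lambda>x. \<Sum>j\<in>S - {i}. dist z (x j)) \<in> borel_measurable (P k)"
    using S by (intro measurable_sum_dist) auto
  note [measurable] = measurable_sum_dist[OF S']
  \<comment> \<open>The equation of the two sums is solved for the distance of the point i, which
    occurs on one side only.\<close>
  have "AE x in P k. dist z (x i) \<noteq> (\<Sum>j\<in>S'. dist z (x j)) + c - (\<Sum>j\<in>S - {i}. dist z (x j))"
  proof (rule AE_dist_neq)
    fix x :: "nat \<Rightarrow> 'a" and v
    have "(\<Sum>j\<in>S'. dist z ((x(i := v)) j)) = (\<Sum>j\<in>S'. dist z (x j))"
      "(\<Sum>j\<in>S - {i}. dist z ((x(i := v)) j)) = (\<Sum>j\<in>S - {i}. dist z (x j))"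
      using neq by (auto intro!: sum.cong)
    then show "(\<Sum>j\<in>S'. dist z ((x(i := v)) j)) + c - (\<Sum>j\<in>S - {i}. dist z ((x(i := v)) j)) =
        (\<Sum>j\<in>S'. dist z (x j)) + c - (\<Sum>j\<in>S - {i}. dist z (x j))"
      by simp
  qed (use neq S in auto)
  then show ?thesis
    by eventually_elim (simp add: sum.remove[OF fin neq(1)] algebra_simps)
qed

lemma AE_D_neq:
  assumes "0 < k"
  shows "AE x in P k. D k x \<noteq> c"
  using AE_sum_dist_neq[of "{0..<k}" k "{}" 0 c] assms by (simp add: Dz_tup atLeast0LessThan)

lemma AE_inj_Dz: "AE x in P k. inj_on (\<lambda>S. Dz z (nths (tup k x) S)) (Pow {0..<k})"
proof -
  have "AE x in P k. \<forall>S\<in>Pow {0..<k}. \<forall>S'\<in>Pow {0..<k}.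
      S \<noteq> S' \<longrightarrow> Dz z (nths (tup k x) S) \<noteq> Dz z (nths (tup k x) S')"
  proof (intro AE_finite_allI AE_impI)
    fix S S' assume S: "S \<in> Pow {0..<k}" and S': "S' \<in> Pow {0..<k}" and "S \<noteq> S'"
    then obtain i where "i \<in> S \<and> i \<notin> S' \<or> i \<in> S' \<and> i \<notin> S"
      by blast
    then show "AE x in P k. Dz z (nths (tup k x) S) \<noteq> Dz z (nths (tup k x) S')"
      using AE_sum_dist_neq[of S k S' i 0] AE_sum_dist_neq[of S' k S i 0] S S'
      by (auto simp: Dz_nths_tup)
  qed auto
  then show ?thesis
    by eventually_elim (auto simp: inj_on_def)
qed

section \<open>Jumps of the Boltzmann factor and their integrals\<close>

lemma expm_psi: "expm (psi t xs) = expm (\<phi> xs) * (if ereal (Dz z xs) < t then expm (\<phi> (y # xs)) else 1)"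
proof -
  have "\<phi> (xs @ [y]) = \<phi> (y # xs)"
    using sym unfolding symmetric_pot_def by simp
  then show ?thesis
    using rep by (simp add: ppin_def pin_singleton expm_add repulsive_pot_def)
qed

text \<open>Up to the Boltzmann factor of \<phi>, the one at time t is the product of exp(-\<phi>(y,
  x_S)) over the nonempty S with D(x_S) < t. The telescoping identity lists its jumps, and the
  product of the factors preceding S reassembles to the Boltzmann factor at time D(x_S).\<close>

lemma expm_Ham_psi_telescope:
  assumes inj: "inj_on (\<lambda>S. Dz z (nths xs S)) (Pow {0..<length xs})"
  shows "expm (Ham (psi t) xs) = expm (Ham \<phi> xs) -
    (\<Sum>S\<in>Pow {0..<length xs} - {{}}. if ereal (Dz z (nths xs S)) < t
      then (1 - expm (\<phi> (y # nths xs S))) * expm (Ham (psi (ereal (Dz z (nths xs S)))) xs) else 0)"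
proof -
  define B where "B = Pow {0..<length xs} - {{}}"
  define d where "d S = Dz z (nths xs S)" for S
  define Q where "Q S = expm (\<phi> (y # nths xs S))" for S
  have fin: "finite B"
    by (simp add: B_def)
  have Ham: "expm (Ham (psi t) xs) = expm (Ham \<phi> xs) * prod Q {S\<in>B. ereal (d S) < t}" for t
  proof -
    have "expm (Ham (psi t) xs) = (\<Prod>S\<in>B. expm (psi t (nths xs S)))"
      using repulsive_ppin[OF rep] by (simp add: Ham_def expm_sum repulsive_pot_def B_def)
    also have "\<dots> = (\<Prod>S\<in>B. expm (\<phi> (nths xs S))) * (\<Prod>S\<in>B. if ereal (d S) < t then Q S else 1)"
      unfolding expm_psi d_def Q_def prod.distrib ..
    also have "(\<Prod>S\<in>B. expm (\<phi> (nths xs S))) = expm (Ham \<phi> xs)"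
      using rep by (simp add: Ham_def expm_sum repulsive_pot_def B_def)
    finally show ?thesis
      unfolding prod.inter_filter[OF fin, of Q "\<lambda>S. ereal (d S) < t"] .
  qed
  define B' where "B' = {S\<in>B. ereal (d S) < t}"
  have "inj_on d (Pow {0..<length xs})"
    using inj by (simp add: d_def[abs_def])
  then have "inj_on d B'"
    by (rule inj_on_subset) (auto simp: B'_def B_def)
  then have "1 - prod Q B' = (\<Sum>S\<in>B'. (1 - Q S) * prod Q {S'\<in>B'. d S' < d S})"
    by (intro one_minus_prod_telescope) (auto simp: B'_def fin)
  \<comment> \<open>Every S' with \<open>d S' < d S\<close> satisfies \<open>d S' < t\<close>
    already, so the product no longer depends on \<open>t\<close>.\<close>
  also have "\<dots> = (\<Sum>S\<in>B'. (1 - Q S) * prod Q {S'\<in>B. ereal (d S') < ereal (d S)})"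
    by (intro sum.cong arg_cong2[where f = "(*)"] refl arg_cong2[where f = prod])
      (auto simp: B'_def intro: less_trans[of _ "ereal _"])
  finally have *: "1 - prod Q B' = (\<Sum>S\<in>B'. (1 - Q S) * prod Q {S'\<in>B. ereal (d S') < ereal (d S)})" .
  have "expm (Ham \<phi> xs) - expm (Ham (psi t) xs) = expm (Ham \<phi> xs) * (1 - prod Q B')"
    unfolding Ham[of t] B'_def by (simp add: algebra_simps)
  also have "\<dots> = (\<Sum>S\<in>B'. (1 - Q S) * expm (Ham (psi (ereal (d S))) xs))"
    unfolding * Ham sum_distrib_left by (intro sum.cong refl) (simp add: algebra_simps)
  also have "\<dots> = (\<Sum>S\<in>B. if ereal (d S) < t then (1 - Q S) * expm (Ham (psi (ereal (d S))) xs) else 0)"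
    unfolding B'_def using fin by (rule sum.inter_filter)
  finally show ?thesis
    unfolding B_def d_def Q_def by linarith
qed


text \<open>By strictness of the inequality, w itself is still unpinned in
  \<open>psi (D j w)\<close>: this is the potential just before w is switched on.\<close>

definition jump_weight :: "nat \<Rightarrow> (nat \<Rightarrow> 'a) \<Rightarrow> real" where
  "jump_weight j w = (1 - expm (\<phi> (y # tup j w))) * expm (Ham (psi (ereal (D j w))) (tup j w))"

definition pinned_weight :: "nat \<Rightarrow> nat \<Rightarrow> (nat \<Rightarrow> 'a) \<Rightarrow> (nat \<Rightarrow> 'a) \<Rightarrow> real" where
  "pinned_weight j l w v = expm (Ham (pin (psi (ereal (D j w))) (tup j w)) (tup l v))"

definition pinned_integral :: "nat \<Rightarrow> nat \<Rightarrow> (nat \<Rightarrow> 'a) \<Rightarrow> real" where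
  "pinned_integral j l w = (\<integral>v. pinned_weight j l w v \<partial>P l)"

definition jump_integral :: "nat \<Rightarrow> nat \<Rightarrow> ereal \<Rightarrow> real" where
  "jump_integral j l t = (\<integral>w. (if ereal (D j w) < t then jump_weight j w * pinned_integral j l w else 0) \<partial>P j)"

abbreviation T :: "ereal \<Rightarrow> complex" where
  "T t \<equiv> Zpart \<nu> \<Lambda> (psi t) lam"

lemma expm_Ham_bounds: "repulsive_pot \<psi> \<Longrightarrow> 0 \<le> expm (Ham \<psi> xs)" "repulsive_pot \<psi> \<Longrightarrow> expm (Ham \<psi> xs) \<le> 1"
  by (auto intro: expm_nonneg expm_le_1 Ham_nonneg)

lemma rep_psi: "repulsive_pot (psi t)"
  by (rule repulsive_ppin[OF rep])

lemma jump_weight_bounds: "0 \<le> jump_weight j w" "jump_weight j w \<le> 1"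
proof -
  have "0 \<le> expm (\<phi> (y # tup j w))" "expm (\<phi> (y # tup j w)) \<le> 1"
    using rep by (auto intro: expm_nonneg expm_le_1 simp: repulsive_pot_def)
  then show "0 \<le> jump_weight j w" "jump_weight j w \<le> 1"
    using expm_Ham_bounds[OF rep_psi] unfolding jump_weight_def
    by (auto intro!: mult_nonneg_nonneg mult_le_one)
qed

lemma pinned_weight_bounds: "0 \<le> pinned_weight j l w v" "pinned_weight j l w v \<le> 1"
  using expm_Ham_bounds[OF repulsive_pin[OF rep_psi]] by (auto simp: pinned_weight_def)

lemma norm_integral_P_le:
  fixes f :: "(nat \<Rightarrow> 'a) \<Rightarrow> 'b::{banach, second_countable_topology}"
  assumes "\<And>x. norm (f x) \<le> B"
  shows "norm (\<integral>x. f x \<partial>P k) \<le> B * V ^ k"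
proof (cases "integrable (P k) f")
  case True
  have "norm (\<integral>x. f x \<partial>P k) \<le> (\<integral>x. norm (f x) \<partial>P k)"
    by simp
  also have "\<dots> \<le> (\<integral>x. B \<partial>P k)"
    using True assms by (intro integral_mono) auto
  finally show ?thesis
    by (simp add: measure_P mult.commute)
next
  case False
  \<comment> \<open>The Bochner integral of a non-integrable function is 0, so the bound needs no
    measurability of \<open>f\<close>.\<close>
  have "0 \<le> B"
    using order_trans[OF norm_ge_zero assms] .
  then show ?thesis
    using False by (simp add: not_integrable_integral_eq)
qed

lemma integrable_P:
  fixes f :: "(nat \<Rightarrow> 'a) \<Rightarrow> 'b::{banach, second_countable_topology}"
  assumes "f \<in> borel_measurable (P k)" "\<And>x. norm (f x) \<le> B"
  shows "integrable (P k) f"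
  using assms by (intro P.integrable_const_bound[of _ B]) auto

lemma measurable_jump_weight [measurable]: "jump_weight j \<in> borel_measurable (P j)"
  unfolding jump_weight_def[abs_def] by measurable

lemma measurable_pinned_weight [measurable]: "case_prod (pinned_weight j l) \<in> borel_measurable (P j \<Otimes>\<^sub>M P l)"
  unfolding pinned_weight_def[abs_def] case_prod_beta by measurable

lemma measurable_pinned_integral [measurable]: "pinned_integral j l \<in> borel_measurable (P j)"
  unfolding pinned_integral_def[abs_def] by (rule P.borel_measurable_lebesgue_integral) simp

lemma pinned_integral_bounds: "0 \<le> pinned_integral j l w" "pinned_integral j l w \<le> V ^ l"
proof -
  show "0 \<le> pinned_integral j l w"
    unfolding pinned_integral_def by (intro integral_nonneg_AE) (simp add: pinned_weight_bounds)
  have "norm (pinned_integral j l w) \<le> 1 * V ^ l"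
    unfolding pinned_integral_def using pinned_weight_bounds by (intro norm_integral_P_le) auto
  then show "pinned_integral j l w \<le> V ^ l"
    by simp
qed

lemma jump_integrand_bound: "\<bar>if b then jump_weight j w * pinned_integral j l w else 0\<bar> \<le> V ^ l"
  using jump_weight_bounds[of j w] pinned_integral_bounds[of j l w] mult_mono[of "jump_weight j w" 1 "pinned_integral j l w" "V ^ l"] by auto

lemma jump_integral_bound: "\<bar>jump_integral j l t\<bar> \<le> V ^ l * V ^ j"
  unfolding jump_integral_def real_norm_def[symmetric] by (rule norm_integral_P_le) (simp only: real_norm_def jump_integrand_bound)

text \<open>Relabelling x as (w, v) with w = x_S preserves the measure, and the Boltzmann factor at
  time D(w) splits into that of w and that of v pinned at w. The integral therefore depends on S
  through its size alone.\<close>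

lemma integral_jump_term:
  fixes t :: ereal
  assumes S: "S \<subseteq> {0..<k}"
  defines "F \<equiv> \<lambda>x. if ereal (Dz z (nths (tup k x) S)) < t
      then (1 - expm (\<phi> (y # nths (tup k x) S))) * expm (Ham (psi (ereal (Dz z (nths (tup k x) S)))) (tup k x)) else 0"
  shows "integrable (P k) F" and "(\<integral>x. F x \<partial>P k) = jump_integral (card S) (k - card S) t"
proof -
  define xs where "xs = nths (map (\<lambda>i x. x i :: 'a) [0..<k]) S"
  have nths: "nths (tup k x) S = map (\<lambda>f. f x) xs" for x
    by (simp add: xs_def tup_eq_map nths_map del: map_map)
  have xs: "f \<in> P k \<rightarrow>\<^sub>M \<nu>" if "f \<in> set xs" for f
    using that by (auto simp: xs_def dest!: in_set_nthsD)
  have [measurable]: "(\<lambda>x. Dz z (nths (tup k x) S)) \<in> borel_measurable (P k)"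
    unfolding nths by (rule measurable_Dz[OF xs])
  have "(\<lambda>x. \<phi> (map (\<lambda>f. f x) ((\<lambda>_. y) # xs))) \<in> borel_measurable (P k)"
    by (rule measurable_phi) (use xs in \<open>auto simp: space_nu\<close>)
  then have [measurable]: "(\<lambda>x. \<phi> (y # nths (tup k x) S)) \<in> borel_measurable (P k)"
    by (simp add: nths)
  have F [measurable]: "F \<in> borel_measurable (P k)"
    unfolding F_def by measurable
  have F_bound: "norm (F x) \<le> 1" for x
  proof -
    have "0 \<le> expm (\<phi> xs)" "expm (\<phi> xs) \<le> 1" for xs
      using rep by (auto intro: expm_nonneg expm_le_1 simp: repulsive_pot_def)
    then show ?thesis
      using expm_Ham_bounds[OF rep_psi] unfolding F_def
      by (auto simp: abs_mult intro!: mult_le_one)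
  qed
  show "integrable (P k) F"
    by (rule integrable_P[OF F F_bound])
  define j where "j = card S"
  define l where "l = k - card S"
  have fin: "finite S"
    using S finite_subset by blast
  obtain f where f: "bij_betw f S {0..<j}"
    using ex_bij_betw_finite_nat[OF fin] by (auto simp: j_def)
  have "card ({0..<k} - S) = l"
    using S fin by (simp add: l_def card_Diff_subset)
  then obtain g where g: "bij_betw g ({0..<k} - S) {0..<l}"
    using ex_bij_betw_finite_nat[of "{0..<k} - S"] by auto
  let ?m = "split_merge k S f g"
  have m [measurable]: "?m \<in> P j \<Otimes>\<^sub>M P l \<rightarrow>\<^sub>M P k"
    unfolding nuL_def by (rule measurable_split_merge[OF S f g])
  have distr: "distr (P j \<Otimes>\<^sub>M P l) (P k) ?m = P k"
    unfolding nuL_def by (rule distr_split_merge[OF R.sigma_finite_measure_axioms S f g])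
  interpret PP: pair_sigma_finite "P j" "P l" ..
  interpret PP: finite_measure "P j \<Otimes>\<^sub>M P l"
    by (rule finite_measure_pair_measure) (rule finite_P)+
  define G where "G w v = (if ereal (D j w) < t then jump_weight j w * pinned_weight j l w v else 0)" for w v
  have FG: "F (?m (w, v)) = G w v" for w v
  proof -
    have "f ` (S \<inter> S) = {0..<j}"
      using f by (simp add: bij_betw_def)
    \<comment> \<open>x_S and w agree as multisets, which is all that D and a symmetric potential
      see.\<close>
    then have "mset (nths (tup k (?m (w, v))) S) = mset (tup j w)"
      unfolding mset_nths_tup[OF S] image_mset_split_merge[OF S f g S]
      by (simp add: tup_def)
    then have "Dz z (nths (tup k (?m (w, v))) S) = D j w"
      "\<phi> (y # nths (tup k (?m (w, v))) S) = \<phi> (y # tup j w)"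
      using sym by (auto simp: Dz_mset symmetric_pot_def)
    then show ?thesis
      by (simp add: F_def G_def jump_weight_def pinned_weight_def expm_Ham_split_merge[OF symmetric_ppin[OF sym] rep_psi S f g])
  qed
  have [measurable]: "case_prod G \<in> borel_measurable (P j \<Otimes>\<^sub>M P l)"
    using measurable_compose[OF m F] by (rule measurable_cong[THEN iffD1, rotated]) (auto simp: FG)
  have G_int: "integrable (P j \<Otimes>\<^sub>M P l) (case_prod G)"
  proof (rule PP.integrable_const_bound[of _ 1])
    show "AE x in P j \<Otimes>\<^sub>M P l. norm (case_prod G x) \<le> 1"
      using FG F_bound by (intro AE_I2) (metis case_prod_conv surj_pair)
  qed simp
  have "(\<integral>x. F x \<partial>P k) = (\<integral>x. F x \<partial>distr (P j \<Otimes>\<^sub>M P l) (P k) ?m)"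
    by (simp add: distr)
  also have "\<dots> = (\<integral>p. case_prod G p \<partial>(P j \<Otimes>\<^sub>M P l))"
    by (subst integral_distr[OF m F]) (auto intro!: Bochner_Integration.integral_cong simp: FG)
  also have "\<dots> = (\<integral>w. (\<integral>v. G w v \<partial>P l) \<partial>P j)"
    by (rule PP.integral_fst[OF G_int, symmetric])
  also have "\<dots> = jump_integral j l t"
    unfolding jump_integral_def pinned_integral_def G_def
    by (intro Bochner_Integration.integral_cong refl) simp
  finally show "(\<integral>x. F x \<partial>P k) = jump_integral (card S) (k - card S) t"
    by (simp add: j_def l_def)
qed

section \<open>Expansion of the partition function along the path\<close>

definition config_integral :: "nat \<Rightarrow> ereal \<Rightarrow> real" where
  "config_integral k t = (\<integral>x. expm (Ham (psi t) (tup k x)) \<partial>P k)"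

text \<open>The empty subset, which would contribute for \<open>j = 0\<close>, causes no jump.\<close>
definition jump_coeff :: "nat \<Rightarrow> nat \<Rightarrow> ereal \<Rightarrow> real" where
  "jump_coeff j l t = (if j = 0 then 0 else jump_integral j l t)"

text \<open>The telescoped identity holds almost everywhere because the D(x_S) are almost surely
  distinct. After integration, subsets of equal size contribute equally, which produces the binomial
  coefficients.\<close>

lemma config_integral_eq:
  "config_integral k t = config_integral k 0 - (\<Sum>j\<le>k. of_nat (k choose j) * jump_coeff j (k - j) t)"
proof -
  define F where "F S x = (if ereal (Dz z (nths (tup k x) S)) < t
      then (1 - expm (\<phi> (y # nths (tup k x) S))) * expm (Ham (psi (ereal (Dz z (nths (tup k x) S)))) (tup k x)) else 0)" for S x
  have F: "integrable (P k) (F S)" "(\<integral>x. F S x \<partial>P k) = jump_integral (card S) (k - card S) t" if "S \<subseteq> {0..<k}" for S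
    using integral_jump_term[OF that, of t] by (simp_all add: F_def[abs_def])
  have int: "integrable (P k) (\<lambda>x. expm (Ham (psi t) (tup k x)))" for t
    using expm_Ham_bounds[OF rep_psi] by (intro integrable_P[of _ _ 1]) auto
  have int0: "integrable (P k) (\<lambda>x. expm (Ham \<phi> (tup k x)))"
    using int[of 0] by (simp add: ppin_0)
  have "AE x in P k. expm (Ham (psi t) (tup k x)) = expm (Ham \<phi> (tup k x)) - (\<Sum>S\<in>Pow {0..<k} - {{}}. F S x)"
    using AE_inj_Dz[of k] by eventually_elim (use expm_Ham_psi_telescope in \<open>simp add: F_def\<close>)
  then have "config_integral k t = (\<integral>x. expm (Ham \<phi> (tup k x)) - (\<Sum>S\<in>Pow {0..<k} - {{}}. F S x) \<partial>P k)"
    unfolding config_integral_def using int[of t] int0 F(1)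
    by (intro integral_cong_AE) (auto intro!: borel_measurable_diff borel_measurable_sum dest: borel_measurable_integrable)
  also have "\<dots> = config_integral k 0 - (\<Sum>S\<in>Pow {0..<k} - {{}}. \<integral>x. F S x \<partial>P k)"
    using int0 F(1)
    by (subst Bochner_Integration.integral_diff) (auto simp: config_integral_def ppin_0 Bochner_Integration.integral_sum)
  also have "(\<Sum>S\<in>Pow {0..<k} - {{}}. \<integral>x. F S x \<partial>P k) = (\<Sum>S\<in>Pow {0..<k} - {{}}. jump_coeff (card S) (k - card S) t)"
    using F(2) by (intro sum.cong refl) (auto simp: jump_coeff_def card_eq_0_iff dest: finite_subset)
  also have "\<dots> = (\<Sum>S\<in>Pow {0..<k}. jump_coeff (card S) (k - card S) t)"
    by (intro sum.mono_neutral_left) (auto simp: jump_coeff_def)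
  also have "\<dots> = (\<Sum>j\<le>k. of_nat (k choose j) * jump_coeff j (k - j) t)"
    by (rule sum_Pow_by_card)
  finally show ?thesis .
qed

text \<open>Majorant of the k-point term of every partition function with repulsive potential, since
  0 \<le> exp(-H) \<le> 1.\<close>

definition exp_term :: "nat \<Rightarrow> real" where
  "exp_term k = (norm lam * V) ^ k / fact k"

lemma exp_term_sums: "exp_term sums exp (norm lam * V)"
  using exp_converges[of "norm lam * V"] by (simp add: exp_term_def[abs_def] divide_inverse mult.commute)

lemma summable_exp_term: "summable exp_term"
  using exp_term_sums by (rule sums_summable)

lemma exp_term_nonneg: "0 \<le> exp_term k"
  by (simp add: exp_term_def)

lemma norm_coeff: "norm (lam ^ k / of_real (fact k)) = norm lam ^ k / fact k"
  by (simp add: norm_divide norm_power del: of_real_fact)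

lemma norm_coeff_mult_le:
  assumes "norm r \<le> V ^ k"
  shows "norm (lam ^ k / of_real (fact k) * r) \<le> exp_term k"
proof -
  have "norm (lam ^ k / of_real (fact k) * r) = norm lam ^ k / fact k * norm r"
    by (simp only: norm_mult norm_coeff)
  also have "\<dots> \<le> norm lam ^ k / fact k * V ^ k"
    using assms by (intro mult_left_mono) auto
  finally show ?thesis
    by (simp add: exp_term_def power_mult_distrib)
qed

lemma Zpart_bound:
  assumes "repulsive_pot \<psi>"
  shows "(\<lambda>k. lam ^ k / of_real (fact k) * of_real (\<integral>x. expm (Ham \<psi> (tup k x)) \<partial>P k)) sums Zpart \<nu> \<Lambda> \<psi> lam"
    and "norm (Zpart \<nu> \<Lambda> \<psi> lam) \<le> exp (norm lam * V)"
proof -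
  have bnd: "norm (lam ^ k / of_real (fact k) * of_real (\<integral>x. expm (Ham \<psi> (tup k x)) \<partial>P k) :: complex) \<le> exp_term k" for k
  proof (rule norm_coeff_mult_le)
    have "norm (\<integral>x. expm (Ham \<psi> (tup k x)) \<partial>P k) \<le> 1 * V ^ k"
      using expm_Ham_bounds[OF assms] by (intro norm_integral_P_le) auto
    then show "norm (of_real (\<integral>x. expm (Ham \<psi> (tup k x)) \<partial>P k) :: complex) \<le> V ^ k"
      by simp
  qed
  show "(\<lambda>k. lam ^ k / of_real (fact k) * of_real (\<integral>x. expm (Ham \<psi> (tup k x)) \<partial>P k)) sums Zpart \<nu> \<Lambda> \<psi> lam"
    unfolding Zpart_def
    by (intro summable_sums summable_comparison_test'[OF summable_exp_term] bnd)
  show "norm (Zpart \<nu> \<Lambda> \<psi> lam) \<le> exp (norm lam * V)"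
    unfolding Zpart_def sums_unique[OF exp_term_sums]
    by (intro norm_suminf_le summable_exp_term bnd)
qed

text \<open>The numerator of \<kappa>(w | y_{\<prec>w}) without the power of \<open>lam\<close>; its
  denominator is \<open>T (D j w)\<close>.\<close>

definition pinned_Z :: "nat \<Rightarrow> (nat \<Rightarrow> 'a) \<Rightarrow> complex" where
  "pinned_Z j w = Zpart \<nu> \<Lambda> (pin (psi (ereal (D j w))) (tup j w)) lam"

lemma pinned_Z_sums: "(\<lambda>l. lam ^ l / of_real (fact l) * of_real (pinned_integral j l w)) sums pinned_Z j w"
  using Zpart_bound(1)[OF repulsive_pin[OF rep_psi]] by (simp add: pinned_Z_def pinned_integral_def pinned_weight_def)

lemma pinned_Z_bound: "norm (pinned_Z j w) \<le> exp (norm lam * V)"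
  unfolding pinned_Z_def by (rule Zpart_bound(2)[OF repulsive_pin[OF rep_psi]])

lemma measurable_pinned_Z [measurable]: "pinned_Z j \<in> borel_measurable (P j)"
proof -
  have "pinned_Z j = (\<lambda>w. \<Sum>l. lam ^ l / of_real (fact l) * of_real (pinned_integral j l w))"
    using sums_unique[OF pinned_Z_sums] by auto
  then show ?thesis
    by simp
qed

lemma measurable_T_D [measurable]: "(\<lambda>w. T (ereal (D j w))) \<in> borel_measurable (P j)"
proof -
  have [measurable]: "(\<lambda>w. \<integral>v. expm (Ham (psi (ereal (D j w))) (tup l v)) \<partial>P l) \<in> borel_measurable (P j)" for l
    using measurable_expm_Ham_psi_pair[of j l]
    by (intro P.borel_measurable_lebesgue_integral) (simp add: case_prod_beta)
  show ?thesis
    unfolding Zpart_def by measurable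
qed

lemma T_bound: "norm (T t) \<le> exp (norm lam * V)"
  by (rule Zpart_bound(2)[OF rep_psi])

text \<open>The jumps of all k-point terms form a double sum over j = |S| and l = k - j, dominated
  by a product of exponential series. Summing over l first resums the points outside S into the
  partition function pinned at w.\<close>

lemma T_expansion:
  "T t = T 0 - (\<Sum>j. lam ^ Suc j / of_real (fact (Suc j)) *
      (\<integral>w. (if ereal (D (Suc j) w) < t then of_real (jump_weight (Suc j) w) * pinned_Z (Suc j) w else 0) \<partial>P (Suc j)))" (is "_ = _ - (\<Sum>j. ?f j)")
proof -
  define f where "f j l = lam ^ j / of_real (fact j) * (lam ^ l / of_real (fact l)) * of_real (jump_coeff j l t)" for j l
  have f_bound: "norm (f j l) \<le> exp_term j * exp_term l" for j l
  proof -
    have "\<bar>jump_coeff j l t\<bar> \<le> V ^ l * V ^ j"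
      using jump_integral_bound[of j l t] by (simp add: jump_coeff_def)
    then have "norm lam ^ j / fact j * (norm lam ^ l / fact l) * \<bar>jump_coeff j l t\<bar>
        \<le> norm lam ^ j / fact j * (norm lam ^ l / fact l) * (V ^ l * V ^ j)"
      by (intro mult_left_mono) auto
    also have "\<dots> = exp_term j * exp_term l"
      by (simp add: exp_term_def power_mult_distrib)
    finally show ?thesis
      by (simp only: f_def norm_mult norm_coeff norm_of_real)
  qed
  note anti = suminf_antidiagonal[of f exp_term exp_term, OF f_bound summable_exp_term summable_exp_term exp_term_nonneg exp_term_nonneg]
  have row: "(\<Sum>l. f j l) = lam ^ j / of_real (fact j) *
      (\<integral>w. (if ereal (D j w) < t then of_real (jump_weight j w) * pinned_Z j w else 0) \<partial>P j)" if "j \<noteq> 0" for j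
  proof -
    define h where "h l w = lam ^ l / of_real (fact l) * of_real (if ereal (D j w) < t then jump_weight j w * pinned_integral j l w else 0)" for l w
    have h_bound: "norm (h l w) \<le> exp_term l" for l w
      unfolding h_def using jump_integrand_bound by (intro norm_coeff_mult_le) (simp only: norm_of_real)
    have h_meas [measurable]: "h l \<in> borel_measurable (P j)" for l
      unfolding h_def[abs_def] by measurable
    \<comment> \<open>Sum and integral are exchanged by the majorant \<open>exp_term\<close>, so
      that the series in l can be formed pointwise in w.\<close>
    have "(\<integral>w. (\<Sum>l. h l w) \<partial>P j) = (\<Sum>l. \<integral>w. h l w \<partial>P j)"
    proof (rule integral_suminf)
      show "integrable (P j) (h l)" for l
        by (rule integrable_P[OF h_meas h_bound])
      show "AE w in P j. summable (\<lambda>l. norm (h l w))"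
        by (intro AE_I2 summable_comparison_test'[OF summable_exp_term]) (simp add: h_bound)
      show "summable (\<lambda>l. \<integral>w. norm (h l w) \<partial>P j)"
      proof (rule summable_comparison_test')
        show "summable (\<lambda>l. exp_term l * V ^ j)"
          by (intro summable_mult2 summable_exp_term)
        show "norm (\<integral>w. norm (h l w) \<partial>P j) \<le> exp_term l * V ^ j" for l
          by (rule norm_integral_P_le) (simp add: h_bound)
      qed
    qed
    also have "(\<lambda>w. \<Sum>l. h l w) = (\<lambda>w. if ereal (D j w) < t then of_real (jump_weight j w) * pinned_Z j w else 0)"
    proof
      fix w
      have "(\<lambda>l. of_real (jump_weight j w) * (lam ^ l / of_real (fact l) * of_real (pinned_integral j l w))) sums (of_real (jump_weight j w) * pinned_Z j w)"
        by (intro sums_mult pinned_Z_sums)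
      then show "(\<Sum>l. h l w) = (if ereal (D j w) < t then of_real (jump_weight j w) * pinned_Z j w else 0)"
        by (auto simp: h_def sums_iff mult_ac)
    qed
    finally have 1: "(\<Sum>l. \<integral>w. h l w \<partial>P j) = (\<integral>w. (if ereal (D j w) < t then of_real (jump_weight j w) * pinned_Z j w else 0) \<partial>P j)"
      by simp
    have hl: "(\<integral>w. h l w \<partial>P j) = lam ^ l / of_real (fact l) * of_real (jump_integral j l t)" for l
      unfolding h_def jump_integral_def by (simp only: integral_mult_right_zero integral_complex_of_real)
    have "summable (\<lambda>l. \<integral>w. h l w \<partial>P j)"
    proof (rule summable_comparison_test')
      show "summable (\<lambda>l. exp_term l * V ^ j)"
        by (intro summable_mult2 summable_exp_term)
      show "norm (\<integral>w. h l w \<partial>P j) \<le> exp_term l * V ^ j" for l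
        by (rule norm_integral_P_le) (simp add: h_bound)
    qed
    then have "(\<Sum>l. lam ^ j / of_real (fact j) * (\<integral>w. h l w \<partial>P j)) = lam ^ j / of_real (fact j) * (\<Sum>l. \<integral>w. h l w \<partial>P j)"
      by (rule suminf_mult)
    moreover have "f j l = lam ^ j / of_real (fact j) * (\<integral>w. h l w \<partial>P j)" for l
      using that by (simp add: hl f_def jump_coeff_def)
    ultimately show ?thesis
      using 1 by simp
  qed
  have row0: "(\<Sum>l. f 0 l) = 0"
    by (simp add: f_def jump_coeff_def)
  have diag: "(\<Sum>j\<le>k. f j (k - j)) = lam ^ k / of_real (fact k) * of_real (config_integral k 0) - lam ^ k / of_real (fact k) * of_real (config_integral k t)" for k
  proof -
    \<comment> \<open>(k choose j)/k! = 1/(j! (k - j)!) is what decouples the two indices.\<close>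
    have "f j (k - j) = lam ^ k / of_real (fact k) * of_real (of_nat (k choose j) * jump_coeff j (k - j) t)" if "j \<le> k" for j
    proof -
      have "lam ^ j * lam ^ (k - j) = lam ^ k"
        using that by (simp add: power_add[symmetric])
      then show ?thesis
        using that by (simp add: f_def binomial_fact field_simps)
    qed
    then have "(\<Sum>j\<le>k. f j (k - j)) = lam ^ k / of_real (fact k) * of_real (\<Sum>j\<le>k. of_nat (k choose j) * jump_coeff j (k - j) t)"
      by (simp add: sum_distrib_left)
    also have "(\<Sum>j\<le>k. of_nat (k choose j) * jump_coeff j (k - j) t) = config_integral k 0 - config_integral k t"
      using config_integral_eq[of k t] by simp
    finally show ?thesis
      by (simp add: algebra_simps)
  qed
  have T: "(\<lambda>k. lam ^ k / of_real (fact k) * of_real (config_integral k s)) sums T s" for s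
    using Zpart_bound(1)[OF rep_psi] by (simp add: config_integral_def)
  have "(\<lambda>k. \<Sum>j\<le>k. f j (k - j)) sums (T 0 - T t)"
    unfolding diag by (intro sums_diff T)
  then have "T 0 - T t = (\<Sum>j. \<Sum>l. f j l)"
    using anti(1) by (rule sums_unique2)
  \<comment> \<open>The row j = 0 vanishes, so the sum starts at one chosen point.\<close>
  also have "\<dots> = (\<Sum>j. \<Sum>l. f (Suc j) l)"
    using suminf_split_head[OF anti(2)] row0 by simp
  also have "\<dots> = (\<Sum>j. ?f j)"
    by (simp add: row del: power_Suc fact_Suc)
  finally have eq: "T 0 - T t = (\<Sum>j. ?f j)" .
  show "T t = T 0 - (\<Sum>j. ?f j)"
    unfolding eq[symmetric] by simp
qed

section \<open>The continuous clock N\<close>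

definition sublevel_measure :: "nat \<Rightarrow> ereal \<Rightarrow> real" where
  "sublevel_measure j t = measure (P j) {w\<in>space (P j). ereal (D j w) < t}"

text \<open>The index starts at one point: the empty tuple has D = 0 and would put an atom at 0,
  destroying continuity.\<close>

definition N :: "ereal \<Rightarrow> real" where
  "N t = (\<Sum>j. norm lam ^ Suc j / fact (Suc j) * sublevel_measure (Suc j) t)"

lemma measurable_sublevel [measurable]: "{w\<in>space (P j). ereal (D j w) < t} \<in> sets (P j)"
  by measurable

lemma sublevel_measure_bounds: "0 \<le> sublevel_measure j t" "sublevel_measure j t \<le> V ^ j"
  using P.bounded_measure[of j] by (auto simp: sublevel_measure_def measure_P[symmetric])

lemma N_term_bound: "norm (norm lam ^ Suc j / fact (Suc j) * sublevel_measure (Suc j) t) \<le> exp_term (Suc j)"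
proof -
  have "norm lam ^ Suc j / fact (Suc j) * sublevel_measure (Suc j) t \<le> norm lam ^ Suc j / fact (Suc j) * V ^ Suc j"
    by (intro mult_left_mono sublevel_measure_bounds(2)) auto
  then show ?thesis
    using sublevel_measure_bounds(1)[of "Suc j" t] by (simp add: abs_mult exp_term_def power_mult_distrib del: power_Suc fact_Suc)
qed

lemma summable_exp_term_Suc: "summable (\<lambda>j. exp_term (Suc j))"
  using summable_exp_term by (subst summable_Suc_iff)

lemma N_sums: "(\<lambda>j. norm lam ^ Suc j / fact (Suc j) * sublevel_measure (Suc j) t) sums N t"
  unfolding N_def by (intro summable_sums summable_comparison_test'[OF summable_exp_term_Suc] N_term_bound)

lemma sublevel_measure_diff:
  assumes "s \<le> t"
  shows "sublevel_measure j t - sublevel_measure j s = measure (P j) {w\<in>space (P j). s \<le> ereal (D j w) \<and> ereal (D j w) < t}"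
proof -
  have "{w\<in>space (P j). s \<le> ereal (D j w) \<and> ereal (D j w) < t} =
      {w\<in>space (P j). ereal (D j w) < t} - {w\<in>space (P j). ereal (D j w) < s}"
    by auto
  moreover have "{w\<in>space (P j). ereal (D j w) < s} \<subseteq> {w\<in>space (P j). ereal (D j w) < t}"
    using assms by auto
  ultimately show ?thesis
    using P.finite_measure_Diff[OF measurable_sublevel measurable_sublevel] by (simp add: sublevel_measure_def)
qed

lemma N_mono:
  assumes "s \<le> t"
  shows "N s \<le> N t"
proof (rule sums_le[OF _ N_sums N_sums])
  fix j
  have "0 \<le> sublevel_measure (Suc j) t - sublevel_measure (Suc j) s"
    unfolding sublevel_measure_diff[OF assms] by (rule measure_nonneg)
  then show "norm lam ^ Suc j / fact (Suc j) * sublevel_measure (Suc j) s \<le> norm lam ^ Suc j / fact (Suc j) * sublevel_measure (Suc j) t"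
    by (intro mult_left_mono) auto
qed

text \<open>By dominated convergence: along s -> t the indicator of D(w) < s is eventually constant
  unless D(w) = t. This exceptional event is null for finite t and impossible for infinite t, so the
  end point \<infinity> is included.\<close>

lemma sublevel_measure_continuous:
  assumes "0 < j"
  shows "continuous_on A (sublevel_measure j)"
  unfolding continuous_on_def
proof
  fix t :: ereal assume "t \<in> A"
  have AE_t: "AE w in P j. ereal (D j w) \<noteq> t"
  proof (cases t)
    case (real r)
    then show ?thesis
      using AE_D_neq[OF assms, of r] by simp
  qed auto
  show "(sublevel_measure j \<longlongrightarrow> sublevel_measure j t) (at t within A)"
    unfolding tendsto_at_iff_sequentially
  proof (intro allI impI)
    fix X assume X: "X \<longlonglongrightarrow> t"
    define f where "f s w = (indicator {w\<in>space (P j). ereal (D j w) < s} w :: real)" for s w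
    have f: "sublevel_measure j s = (\<integral>w. f s w \<partial>P j)" for s
      by (simp add: f_def sublevel_measure_def)
    have "(\<lambda>n. \<integral>w. f (X n) w \<partial>P j) \<longlonglongrightarrow> (\<integral>w. f t w \<partial>P j)"
    proof (rule integral_dominated_convergence[where w = "\<lambda>_. 1"])
      show "AE w in P j. (\<lambda>n. f (X n) w) \<longlonglongrightarrow> f t w"
        using AE_t
      proof eventually_elim
        case (elim w)
        then have "\<forall>\<^sub>F n in sequentially. f (X n) w = f t w"
        proof (cases "ereal (D j w) < t")
          case True
          from order_tendstoD(1)[OF X True] show ?thesis
            by eventually_elim (use True in \<open>auto simp: f_def indicator_def\<close>)
        next
          case False
          with elim have "t < ereal (D j w)"
            by simp
          from order_tendstoD(2)[OF X this] show ?thesis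
            by eventually_elim (use False in \<open>auto simp: f_def indicator_def\<close>)
        qed
        then show ?case
          by (rule tendsto_eventually)
      qed
    qed (auto simp: f_def indicator_def)
    then show "(sublevel_measure j \<circ> X) \<longlonglongrightarrow> sublevel_measure j t"
      by (simp add: o_def f)
  qed
qed

lemma N_continuous: "continuous_on A N"
proof (rule uniform_limit_theorem)
  show "\<forall>\<^sub>F n in sequentially. continuous_on A (\<lambda>t. \<Sum>j<n. norm lam ^ Suc j / fact (Suc j) * sublevel_measure (Suc j) t)"
    by (intro always_eventually allI continuous_intros sublevel_measure_continuous) auto
  show "uniform_limit A (\<lambda>n t. \<Sum>j<n. norm lam ^ Suc j / fact (Suc j) * sublevel_measure (Suc j) t) N sequentially"
    unfolding N_def[abs_def] by (rule Weierstrass_m_test[OF N_term_bound summable_exp_term_Suc])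
qed simp

section \<open>Sums over configurations restricted to a time window\<close>

definition config_sum :: "(nat \<Rightarrow> (nat \<Rightarrow> 'a) \<Rightarrow> complex) \<Rightarrow> complex" where
  "config_sum G = (\<Sum>j. 1 / of_real (fact (Suc j)) * (\<integral>w. G (Suc j) w \<partial>P (Suc j)))"

text \<open>Half-open, matching the condition D(w) < t of partial pinning: [0,s) and [s,t) partition
  [0,t), so increments in t are again windows.\<close>

definition window :: "ereal \<Rightarrow> ereal \<Rightarrow> (nat \<Rightarrow> (nat \<Rightarrow> 'a) \<Rightarrow> complex) \<Rightarrow> nat \<Rightarrow> (nat \<Rightarrow> 'a) \<Rightarrow> complex" where
  "window s t G j w = (if s \<le> ereal (D j w) \<and> ereal (D j w) < t then G j w else 0)"

text \<open>\<open>config_sum\<close> divides by factorials but leaves the powers of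
  \<open>lam\<close> inside \<open>G\<close>; with this bound its j-point term is at most
  \<open>C * exp_term j\<close>.\<close>

definition admissible :: "real \<Rightarrow> (nat \<Rightarrow> (nat \<Rightarrow> 'a) \<Rightarrow> complex) \<Rightarrow> bool" where
  "admissible C G \<longleftrightarrow> (\<forall>j. G j \<in> borel_measurable (P j)) \<and> (\<forall>j w. norm (G j w) \<le> C * norm lam ^ j)"

lemma admissible_integrable: "admissible C G \<Longrightarrow> integrable (P j) (G j)"
  unfolding admissible_def by (intro integrable_P[of _ _ "C * norm lam ^ j"]) auto

lemma norm_one_div_fact: "norm (1 / of_real (fact k) :: complex) = 1 / fact k"
  by (simp add: norm_divide del: of_real_fact)

lemma config_sum_sums:
  assumes "admissible C G"
  shows "(\<lambda>j. 1 / of_real (fact (Suc j)) * (\<integral>w. G (Suc j) w \<partial>P (Suc j))) sums config_sum G"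
  unfolding config_sum_def
proof (intro summable_sums summable_comparison_test'[OF summable_mult[OF summable_exp_term_Suc]])
  fix j
  have "norm (\<integral>w. G (Suc j) w \<partial>P (Suc j)) \<le> C * norm lam ^ Suc j * V ^ Suc j"
    using assms unfolding admissible_def by (intro norm_integral_P_le) blast
  then have "1 / fact (Suc j) * norm (\<integral>w. G (Suc j) w \<partial>P (Suc j)) \<le> 1 / fact (Suc j) * (C * norm lam ^ Suc j * V ^ Suc j)"
    by (intro mult_left_mono) auto
  also have "\<dots> = C * exp_term (Suc j)"
    by (simp add: exp_term_def power_mult_distrib mult_ac)
  finally show "norm (1 / of_real (fact (Suc j)) * (\<integral>w. G (Suc j) w \<partial>P (Suc j))) \<le> C * exp_term (Suc j)"
    by (simp only: norm_mult norm_one_div_fact)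
qed

lemma config_sum_diff:
  assumes "admissible C G" "admissible C' G'"
  shows "config_sum G - config_sum G' = config_sum (\<lambda>j w. G j w - G' j w)"
proof -
  have "(\<lambda>j. 1 / of_real (fact (Suc j)) * (\<integral>w. G (Suc j) w \<partial>P (Suc j)) -
      1 / of_real (fact (Suc j)) * (\<integral>w. G' (Suc j) w \<partial>P (Suc j))) sums (config_sum G - config_sum G')"
    by (rule sums_diff[OF config_sum_sums[OF assms(1)] config_sum_sums[OF assms(2)]])
  moreover have "1 / of_real (fact (Suc j)) * (\<integral>w. G (Suc j) w \<partial>P (Suc j)) -
      1 / of_real (fact (Suc j)) * (\<integral>w. G' (Suc j) w \<partial>P (Suc j)) =
      1 / of_real (fact (Suc j)) * (\<integral>w. G (Suc j) w - G' (Suc j) w \<partial>P (Suc j))" for j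
    using admissible_integrable[OF assms(1)] admissible_integrable[OF assms(2)]
    by (simp add: right_diff_distrib del: fact_Suc)
  ultimately show ?thesis
    unfolding config_sum_def by (simp only: sums_iff)
qed

lemma config_sum_mult:
  assumes "admissible C G"
  shows "b * config_sum G = config_sum (\<lambda>j w. b * G j w)"
proof -
  have "(\<lambda>j. b * (1 / of_real (fact (Suc j)) * (\<integral>w. G (Suc j) w \<partial>P (Suc j)))) sums (b * config_sum G)"
    by (intro sums_mult config_sum_sums[OF assms])
  moreover have "b * (1 / of_real (fact (Suc j)) * (\<integral>w. G (Suc j) w \<partial>P (Suc j))) =
      1 / of_real (fact (Suc j)) * (\<integral>w. b * G (Suc j) w \<partial>P (Suc j))" for j
    by (simp del: fact_Suc)
  ultimately show ?thesis
    unfolding config_sum_def by (simp only: sums_iff)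
qed

lemma admissible_mult: "admissible C G \<Longrightarrow> admissible (norm b * C) (\<lambda>j w. b * G j w)"
  by (auto simp: admissible_def norm_mult mult.assoc intro: mult_left_mono borel_measurable_times)

lemma admissible_window:
  assumes "\<And>j. G j \<in> borel_measurable (P j)" "0 \<le> C"
    and "\<And>j w. s \<le> ereal (D j w) \<Longrightarrow> ereal (D j w) < t \<Longrightarrow> norm (G j w) \<le> C * norm lam ^ j"
  shows "admissible C (window s t G)"
proof -
  note [measurable] = assms(1)
  have "window s t G j \<in> borel_measurable (P j)" for j
    unfolding window_def[abs_def] by measurable
  then show ?thesis
    using assms by (auto simp: admissible_def window_def)
qed

text \<open>\<open>N t - N s\<close> is the mass of the window under the measure whose distribution
  function is \<open>N\<close>. The bound on \<open>G\<close> is local to the window because in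
  \<open>T_second_order\<close> it comes from D(w) lying between s and t.\<close>

lemma config_sum_window_bound:
  assumes G: "\<And>j. G j \<in> borel_measurable (P j)" and C: "0 \<le> C" and st: "s \<le> t"
    and bnd: "\<And>j w. s \<le> ereal (D j w) \<Longrightarrow> ereal (D j w) < t \<Longrightarrow> norm (G j w) \<le> C * norm lam ^ j"
  shows "norm (config_sum (window s t G)) \<le> C * (N t - N s)"
proof -
  have admissible: "admissible C (window s t G)"
    by (rule admissible_window[OF G C bnd])
  have S: "(\<lambda>j. C * (norm lam ^ Suc j / fact (Suc j) * sublevel_measure (Suc j) t - norm lam ^ Suc j / fact (Suc j) * sublevel_measure (Suc j) s)) sums (C * (N t - N s))"
    by (intro sums_mult sums_diff N_sums)
  have "norm (config_sum (window s t G)) \<le> (\<Sum>j. C * (norm lam ^ Suc j / fact (Suc j) * sublevel_measure (Suc j) t - norm lam ^ Suc j / fact (Suc j) * sublevel_measure (Suc j) s))"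
    unfolding config_sum_def
  proof (rule norm_suminf_le[OF _ sums_summable[OF S]])
    fix j
    define A where "A = {w\<in>space (P (Suc j)). s \<le> ereal (D (Suc j) w) \<and> ereal (D (Suc j) w) < t}"
    have A: "A \<in> sets (P (Suc j))"
      unfolding A_def by measurable
    have "norm (\<integral>w. window s t G (Suc j) w \<partial>P (Suc j)) \<le> (\<integral>w. norm (window s t G (Suc j) w) \<partial>P (Suc j))"
      by simp
    also have "\<dots> \<le> (\<integral>w. C * norm lam ^ Suc j * indicator A w \<partial>P (Suc j))"
    proof (rule integral_mono)
      show "integrable (P (Suc j)) (\<lambda>w. norm (window s t G (Suc j) w))"
        using admissible_integrable[OF admissible] by (rule integrable_norm)
      show "integrable (P (Suc j)) (\<lambda>w. C * norm lam ^ Suc j * indicator A w)"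
        using A by (intro integrable_mult_right integrable_real_indicator) (auto simp: P.emeasure_finite less_top[symmetric])
      show "norm (window s t G (Suc j) w) \<le> C * norm lam ^ Suc j * indicator A w" if "w \<in> space (P (Suc j))" for w
        using bnd[of "Suc j" w] that by (auto simp: window_def A_def indicator_def)
    qed
    also have "\<dots> = C * norm lam ^ Suc j * (sublevel_measure (Suc j) t - sublevel_measure (Suc j) s)"
      using A by (simp add: sublevel_measure_diff[OF st] A_def)
    finally have "1 / fact (Suc j) * norm (\<integral>w. window s t G (Suc j) w \<partial>P (Suc j)) \<le>
        1 / fact (Suc j) * (C * norm lam ^ Suc j * (sublevel_measure (Suc j) t - sublevel_measure (Suc j) s))"
      by (intro mult_left_mono) auto
    also have "\<dots> = C * (norm lam ^ Suc j / fact (Suc j) * sublevel_measure (Suc j) t - norm lam ^ Suc j / fact (Suc j) * sublevel_measure (Suc j) s)"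
      by (simp add: algebra_simps del: fact_Suc power_Suc)
    finally show "norm (1 / of_real (fact (Suc j)) * (\<integral>w. window s t G (Suc j) w \<partial>P (Suc j))) \<le> \<dots>"
      by (simp only: norm_mult norm_one_div_fact)
  qed
  then show ?thesis
    using S by (simp add: sums_iff)
qed

section \<open>The integral equation for T and its solution\<close>

definition log_density :: "nat \<Rightarrow> (nat \<Rightarrow> 'a) \<Rightarrow> complex" where
  "log_density j w = of_real (jump_weight j w) * (lam ^ j * pinned_Z j w / T (ereal (D j w)))"

definition K :: real where
  "K = exp (norm lam * V)"

lemma K_nonneg: "0 \<le> K"
  by (simp add: K_def)

lemma T_D_ge: "\<delta> \<le> norm (T (ereal (D j w)))"
  by (rule zero_free) (simp add: Dz_nonneg)

lemma measurable_log_density [measurable]: "log_density j \<in> borel_measurable (P j)"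
  unfolding log_density_def[abs_def] by measurable

text \<open>\<open>log_density\<close> is the density of dM = -dT/T, the jump weight times
  \<kappa>(w | y_{\<prec>w}). Multiplying by T(D(w)) cancels its denominator and leaves the
  integrand of \<open>T_expansion\<close>.\<close>

lemma log_density_mult_T: "log_density j w * T (ereal (D j w)) = of_real (jump_weight j w) * (lam ^ j * pinned_Z j w)"
  using T_D_ge[of j w] delta_pos by (auto simp: log_density_def)

lemma log_density_mult_T_bound: "norm (log_density j w * T (ereal (D j w))) \<le> K * norm lam ^ j"
proof -
  have "norm (log_density j w * T (ereal (D j w))) = jump_weight j w * (norm lam ^ j * norm (pinned_Z j w))"
    using jump_weight_bounds by (simp add: log_density_mult_T norm_mult norm_power)
  also have "\<dots> \<le> 1 * (norm lam ^ j * K)"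
    unfolding K_def using jump_weight_bounds pinned_Z_bound by (intro mult_mono) auto
  finally show ?thesis
    by (simp add: mult.commute)
qed

text \<open>Zero-freeness is applied at the time D(w), which depends on the configuration; hence the
  lower bound \<delta> is required along the entire path.\<close>

lemma log_density_bound: "norm (log_density j w) \<le> K / \<delta> * norm lam ^ j"
proof -
  have "\<delta> * norm (log_density j w) \<le> norm (T (ereal (D j w))) * norm (log_density j w)"
    by (intro mult_right_mono T_D_ge) simp
  also have "\<dots> \<le> K * norm lam ^ j"
    using log_density_mult_T_bound[of j w] by (simp add: norm_mult mult.commute)
  finally show ?thesis
    using delta_pos by (simp add: field_simps)
qed

definition M :: "ereal \<Rightarrow> complex" where
  "M t = config_sum (window 0 t log_density)"

lemma window_diff: "0 \<le> s \<Longrightarrow> s \<le> t \<Longrightarrow> window 0 t G j w - window 0 s G j w = window s t G j w"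
  by (auto simp: window_def Dz_nonneg)

lemma config_sum_window_diff:
  assumes "\<And>j. G j \<in> borel_measurable (P j)" "0 \<le> C" "\<And>j w. norm (G j w) \<le> C * norm lam ^ j"
    and st: "0 \<le> s" "s \<le> t"
  shows "config_sum (window 0 t G) - config_sum (window 0 s G) = config_sum (window s t G)"
proof -
  have "admissible C (window r r' G)" for r r'
    using assms by (intro admissible_window) auto
  from config_sum_diff[OF this this] show ?thesis
    by (simp only: window_diff[OF st])
qed

text \<open>The expansion becomes a linear Volterra equation: \<open>T t\<close> is
  \<open>T 0\<close> minus the integral of T(D(w)) dM over D(w) < t.\<close>

lemma T_eq: "T t = T 0 - config_sum (window 0 t (\<lambda>j w. log_density j w * T (ereal (D j w))))"
proof -
  have "lam ^ j / of_real (fact j) * (\<integral>w. (if ereal (D j w) < t then of_real (jump_weight j w) * pinned_Z j w else 0) \<partial>P j) =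
      1 / of_real (fact j) * (\<integral>w. window 0 t (\<lambda>j w. log_density j w * T (ereal (D j w))) j w \<partial>P j)" for j
  proof -
    have "(\<integral>w. window 0 t (\<lambda>j w. log_density j w * T (ereal (D j w))) j w \<partial>P j) =
        (\<integral>w. lam ^ j * (if ereal (D j w) < t then of_real (jump_weight j w) * pinned_Z j w else 0) \<partial>P j)"
      by (intro Bochner_Integration.integral_cong refl) (auto simp: window_def log_density_mult_T Dz_nonneg)
    then show ?thesis
      by simp
  qed
  then show ?thesis
    using T_expansion[of t] by (simp only: config_sum_def)
qed

lemma T_diff:
  assumes "0 \<le> s" "s \<le> t"
  shows "T t - T s = - config_sum (window s t (\<lambda>j w. log_density j w * T (ereal (D j w))))"
proof -
  have eq: "config_sum (window 0 t (\<lambda>j w. log_density j w * T (ereal (D j w)))) - config_sum (window 0 s (\<lambda>j w. log_density j w * T (ereal (D j w)))) =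
      config_sum (window s t (\<lambda>j w. log_density j w * T (ereal (D j w))))"
    by (rule config_sum_window_diff[OF _ K_nonneg log_density_mult_T_bound assms]) measurable
  show ?thesis
    unfolding T_eq[of t] T_eq[of s] eq[symmetric] by simp
qed

text \<open>A first-order estimate, to be fed back into the integral equation.\<close>

lemma T_lipschitz:
  assumes "0 \<le> s" "s \<le> t"
  shows "norm (T t - T s) \<le> K * (N t - N s)"
  unfolding T_diff[OF assms] norm_minus_cancel
  by (rule config_sum_window_bound[OF _ K_nonneg assms(2) log_density_mult_T_bound]) measurable

lemma K_div_delta_nonneg: "0 \<le> K / \<delta>"
  using K_nonneg delta_pos by simp

lemma M_diff:
  assumes "0 \<le> s" "s \<le> t"
  shows "M t - M s = config_sum (window s t log_density)"
  unfolding M_def by (rule config_sum_window_diff[OF measurable_log_density K_div_delta_nonneg log_density_bound assms])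

text \<open>By the integral equation the left-hand side is the integral of (T s - T(D(w))) dM over
  the window. There D(w) lies in [s,t), so the Lipschitz bound supplies one factor
  \<open>K * (N t - N s)\<close>, and the mass of dM the other,
  \<open>K / \<delta> * (N t - N s)\<close>.\<close>

lemma T_second_order:
  assumes st: "0 \<le> s" "s \<le> t"
  shows "norm (T t - T s + T s * (M t - M s)) \<le> K / \<delta> * K * (N t - N s)\<^sup>2"
proof -
  let ?h = "\<lambda>j w. log_density j w * T (ereal (D j w))"
  let ?G = "\<lambda>j w. log_density j w * (T s - T (ereal (D j w)))"
  have adm_g: "admissible (K / \<delta>) (window s t log_density)"
    by (rule admissible_window[OF measurable_log_density K_div_delta_nonneg log_density_bound])
  have adm_h: "admissible K (window s t ?h)"
    by (rule admissible_window[OF _ K_nonneg log_density_mult_T_bound]) measurable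
  have "T t - T s + T s * (M t - M s) = T s * config_sum (window s t log_density) - config_sum (window s t ?h)"
    unfolding T_diff[OF st] M_diff[OF st] by simp
  also have "\<dots> = config_sum (\<lambda>j w. T s * window s t log_density j w - window s t ?h j w)"
    unfolding config_sum_mult[OF adm_g] by (rule config_sum_diff[OF admissible_mult[OF adm_g] adm_h])
  also have "(\<lambda>j w. T s * window s t log_density j w - window s t ?h j w) = window s t ?G"
    by (auto simp: window_def fun_eq_iff algebra_simps)
  finally have eq: "T t - T s + T s * (M t - M s) = config_sum (window s t ?G)" .
  have Nst: "0 \<le> N t - N s"
    using N_mono[OF st(2)] by simp
  have "norm (config_sum (window s t ?G)) \<le> K / \<delta> * K * (N t - N s) * (N t - N s)"
  proof (rule config_sum_window_bound[OF _ _ st(2)])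
    fix j w assume w: "s \<le> ereal (D j w)" "ereal (D j w) < t"
    have "norm (T s - T (ereal (D j w))) \<le> K * (N (ereal (D j w)) - N s)"
      using T_lipschitz[OF st(1) w(1)] by (simp add: norm_minus_commute)
    also have "\<dots> \<le> K * (N t - N s)"
      using N_mono[of "ereal (D j w)" t] w(2) K_nonneg by (intro mult_left_mono) auto
    finally have "norm (?G j w) \<le> (K / \<delta> * norm lam ^ j) * (K * (N t - N s))"
      unfolding norm_mult using order_trans[OF norm_ge_zero log_density_bound] by (intro mult_mono log_density_bound) auto
    then show "norm (?G j w) \<le> K / \<delta> * K * (N t - N s) * norm lam ^ j"
      by (simp add: mult_ac)
  next
    show "0 \<le> K / \<delta> * K * (N t - N s)"
      by (intro mult_nonneg_nonneg Nst K_div_delta_nonneg K_nonneg)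
  qed measurable
  then show ?thesis
    unfolding eq by (simp add: power2_eq_square mult.assoc)
qed

text \<open>[0,\<infinity>] is an interval of \<open>ereal\<close> on which \<open>N\<close> is
  continuous, so full pinning is reached at the end point itself, without a limit t ->
  \<infinity>.\<close>

theorem T_exp: "T \<infinity> * exp (M \<infinity>) = T 0"
proof (rule exp_solution_if_quadratic_increments[where N = N and B = K and C = "K / \<delta>" and C' = "K / \<delta> * K"])
  show "norm (M t - M s) \<le> K / \<delta> * (N t - N s)" if "0 \<le> s" "s \<le> t" for s t
    unfolding M_diff[OF that] by (rule config_sum_window_bound[OF measurable_log_density K_div_delta_nonneg that(2) log_density_bound])
  have "window 0 0 log_density = (\<lambda>j w. 0)"
    by (auto simp: window_def fun_eq_iff)
  then show "M 0 = 0"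
    by (simp add: M_def config_sum_def)
  show "norm (T t) \<le> K" for t
    unfolding K_def by (rule T_bound)
qed (auto simp: N_continuous N_mono K_div_delta_nonneg intro: T_second_order[simplified])

text \<open>The window from 0 to \<infinity> imposes no restriction, since 0 \<le> D(w) <
  \<infinity>.\<close>

lemma series_term_eq: "series_term z \<nu> \<Lambda> \<phi> lam y j = 1 / of_real (fact j) * (\<integral>w. window 0 \<infinity> log_density j w \<partial>P j)"
  unfolding series_term_def Let_def
  by (intro arg_cong2[where f = "(*)"] refl Bochner_Integration.integral_cong)
    (simp add: window_def log_density_def jump_weight_def pinned_Z_def kappa_def ppinw_def Dz_nonneg)

lemma series_term_sums: "(\<lambda>j. series_term z \<nu> \<Lambda> \<phi> lam y (Suc j)) sums M \<infinity>"
  unfolding series_term_eq M_def by (rule config_sum_sums[OF admissible_window[OF measurable_log_density K_div_delta_nonneg log_density_bound]])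

lemma kappa_eq_exp: "kappa \<nu> \<Lambda> \<phi> lam [y] = lam * exp (- M \<infinity>)"
proof -
  have "T 0 \<noteq> 0"
    using zero_free[of 0] delta_pos by auto
  moreover have "T \<infinity> = T 0 * exp (- M \<infinity>)"
    unfolding T_exp[symmetric] by (simp add: exp_minus)
  ultimately show ?thesis
    by (simp add: kappa_def ppin_0 ppin_PInf)
qed

end

text \<open>Summability belongs to the claim because \<open>suminf\<close> of a divergent series is
  an unspecified value. The exponent has no term for the empty tuple, hence
  \<open>Suc k\<close>.\<close>

theorem mainTheorem7:
  fixes \<nu> :: "('a::polish_space) measure" and \<Lambda> :: "'a set" and lam :: complex
    and \<Phi> :: "'a potential set" and \<delta> :: real and z :: 'a
  assumes "assumption_A \<nu>"
    and "bounded \<Lambda>" and "\<Lambda> \<in> sets \<nu>"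
    and "\<forall>\<phi>\<in>\<Phi>. is_potential \<nu> \<phi> \<and> symmetric_pot \<phi> \<and> repulsive_pot \<phi>"
    and "closed_under_mod z \<nu> \<Phi>"
    and "\<delta> > 0" and "zero_free \<nu> \<Lambda> lam \<delta> \<Phi>"
    and "\<phi> \<in> \<Phi>"
  shows "summable (\<lambda>k. series_term z \<nu> \<Lambda> \<phi> lam y (Suc k)) \<and>
         kappa \<nu> \<Lambda> \<phi> lam [y] = lam * exp (- (\<Sum>k. series_term z \<nu> \<Lambda> \<phi> lam y (Suc k)))"
proof -
  have sets: "sets \<nu> = sets borel"
    using assms(1) by (simp add: assumption_A_def)
  have dist: "dist z \<in> \<nu> \<rightarrow>\<^sub>M lborel"
    by (subst measurable_cong_sets[OF sets sets_lborel])
      (intro borel_measurable_continuous_onI continuous_intros)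
  have "emeasure \<nu> {x. dist z x = r} = 0" for r
  proof -
    \<comment> \<open>The sphere of radius r is the preimage of the Lebesgue-null set {r} under the
      distance to z.\<close>
    have "absolutely_continuous lborel (distr \<nu> lborel (dist z))"
      using assms(1) by (simp add: assumption_A_def)
    moreover have "{r} \<in> null_sets lborel"
      by (simp add: null_sets_def)
    ultimately have "emeasure (distr \<nu> lborel (dist z)) {r} = 0"
      unfolding absolutely_continuous_def by (metis null_setsD1 subsetD)
    then show ?thesis
      using sets_eq_imp_space_eq[OF sets] by (simp add: emeasure_distr[OF dist] vimage_def)
  qed
  \<comment> \<open>Closure under partial pinning keeps the whole path in \<Phi>, so the lower bound
    \<delta> holds at every time t \<ge> 0.\<close>
  then interpret partially_pinned_gas \<nu> \<Lambda> z \<phi> y lam \<delta>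
    using assms sets
    by unfold_locales (auto simp: assumption_A_def closed_under_mod_def zero_free_def)
  show ?thesis
    using series_term_sums kappa_eq_exp by (simp add: sums_iff)
qed

end
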